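(* Let $\tau=\tau_x+i\tau_y\in\mathbb{C}$ with $\tau_y>0$ and $\Lambda=\mathbb{Z}+\mathbb{Z}\tau$. For a point $z=z_x+iz_y\in\mathbb{C}$, the sequence $nz \bmod \Lambda$ is equidistributed in $\mathbb{C}/\Lambda$ if and only if $$n_1z_x+\frac{n_2-n_1\tau_x}{\tau_y}z_y\notin\mathbb{Z}\quad\text{for every }(n_1,n_2)\in\mathbb{Z}^2\setminus\{(0,0)\}.$$
   Context: A sequence $(z_n)_{n\ge0}$ in the torus $\mathbb{C}/\Lambda$ (identified with $\mathbb{R}^2/\Lambda$ through $z\mapsto(z_x,z_y)$) is equidistributed if $\lim_{N\to\infty}\frac1N\sum_{n=0}^{N-1}f(z_n)=\int f\,d\mu$ for every Riemann integrable $f$ on $\mathbb{R}^2/\Lambda$, where $\mu$ is the normalized Lebesgue measure on a fundamental parallelogram. *)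

theory Defs
  imports "HOL-Analysis.Analysis"
begin

definition lattice :: "complex \<Rightarrow> complex set" where
  "lattice \<tau> = {of_int m + of_int n * \<tau> | m n :: int. True}"

definition lattice_rel :: "complex \<Rightarrow> (complex \<times> complex) set" where
  "lattice_rel \<tau> = {(u, v). u - v \<in> lattice \<tau>}"

text \<open>Points of the torus are the equivalence classes of \<^term>\<open>lattice_rel \<tau>\<close>,
  that is, the elements of \<^term>\<open>UNIV // lattice_rel \<tau>\<close>.\<close>

definition torus_class :: "complex \<Rightarrow> complex \<Rightarrow> complex set" where
  "torus_class \<tau> u = lattice_rel \<tau> `` {u}"

definition fundamental_parallelogram :: "complex \<Rightarrow> complex set" where
  "fundamental_parallelogram \<tau> =
    {of_real s + of_real t * \<tau> | s t :: real. 0 \<le> s \<and> s < 1 \<and> 0 \<le> t \<and> t < 1}"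

text \<open>This differs from Henstock--Kurzweil integrability in that the gauge is constant.\<close>

definition riemann_integrable_cbox ::
    "('a::euclidean_space \<Rightarrow> real) \<Rightarrow> 'a \<Rightarrow> 'a \<Rightarrow> bool" where
  "riemann_integrable_cbox g a b \<longleftrightarrow>
    (\<exists>I. \<forall>e>0. \<exists>d>0. \<forall>p. p tagged_division_of cbox a b \<and> (\<lambda>x. ball x d) fine p \<longrightarrow>
       \<bar>(\<Sum>(x, K)\<in>p. measure lborel K * g x) - I\<bar> < e)"

text \<open>On a bounded set, extend by zero to a box. Requiring the set to lie in the open box
  excludes degenerate boxes, on which every function would be integrable.\<close>

definition riemann_integrable_on ::
    "('a::euclidean_space \<Rightarrow> real) \<Rightarrow> 'a set \<Rightarrow> bool" where
  "riemann_integrable_on g S \<longleftrightarrow>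
    (\<exists>a b. S \<subseteq> box a b \<and> riemann_integrable_cbox (\<lambda>x. if x \<in> S then g x else 0) a b)"

text \<open>The completed measure \<^term>\<open>lebesgue\<close> is needed since a Riemann integrable function
  need not be Borel measurable.\<close>

definition torus_equidistributed :: "complex \<Rightarrow> (nat \<Rightarrow> complex set) \<Rightarrow> bool" where
  "torus_equidistributed \<tau> zs \<longleftrightarrow>
    (\<forall>f :: complex set \<Rightarrow> real.
       riemann_integrable_on (\<lambda>w. f (torus_class \<tau> w)) (fundamental_parallelogram \<tau>) \<longrightarrow>
       (\<lambda>N. (1 / real N) * (\<Sum>n<N. f (zs n))) \<longlonglongrightarrow>
         (\<integral>w. f (torus_class \<tau> w)
            \<partial>(uniform_measure lebesgue (fundamental_parallelogram \<tau>))))"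

end

theory Submission
  imports Defs
begin

text \<open>
  In the coordinates of the basis \<open>1, \<tau>\<close> the condition says that no nontrivial character of the
  torus is trivial at \<open>z\<close>. If it holds, Weyl's method applies: along the orbit the averages of a
  nontrivial character are geometric sums, so they tend to \<open>0\<close>, which is the mean of the character
  because the mean is invariant under translations. By Stone--Weierstrass every continuous periodic
  function has the right averages. A Riemann integrable function \<open>f\<close> is bounded and almost everywhere
  continuous, hence the Lipschitz functions \<open>sup\<^sub>v (f v - k \<bar>v - w\<bar>)\<close> lie above \<open>f\<close> and their means
  tend to that of \<open>f\<close>; the same for \<open>- f\<close> squeezes the averages of \<open>f\<close>. Conversely, if a
  nontrivial character is trivial at \<open>z\<close>, the orbit stays in its kernel, and a bump function
  supported off the kernel has averages \<open>0\<close> but a positive mean.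
\<close>

subsection \<open>Riemann integrability\<close>

text \<open>Because the gauge is constant, one sufficiently fine division is fine for every choice
  of tags. Two choices give Riemann sums within \<open>e / 2\<close> of the same \<open>I\<close>,
  so they differ by less than \<open>e\<close>. Boundedness and almost everywhere continuity both
  come from choosing \<open>x\<close> and \<open>y\<close> well.\<close>

lemma riemann_integrable_cbox_cells:
  fixes g :: "'a::euclidean_space \<Rightarrow> real"
  assumes "riemann_integrable_cbox g a b" "0 < e"
  obtains \<D> where "\<D> division_of cbox a b"
    "\<And>x y. (\<And>K. K \<in> \<D> \<Longrightarrow> x K \<in> K \<and> y K \<in> K) \<Longrightarrow>
       (\<Sum>K\<in>\<D>. measure lborel K * (g (x K) - g (y K))) < e"
proof -
  from assms(1) obtain I where I: "\<And>e. 0 < e \<Longrightarrow> \<exists>d>0. \<forall>p. p tagged_division_of cbox a b \<and>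
      (\<lambda>x. ball x d) fine p \<longrightarrow> \<bar>(\<Sum>(x, K)\<in>p. measure lborel K * g x) - I\<bar> < e"
    unfolding riemann_integrable_cbox_def by blast
  obtain d where "0 < d" and d: "\<And>p. p tagged_division_of cbox a b \<Longrightarrow> (\<lambda>x. ball x d) fine p
      \<Longrightarrow> \<bar>(\<Sum>(x, K)\<in>p. measure lborel K * g x) - I\<bar> < e / 2"
    using I[of "e/2"] assms(2) by auto
  \<comment> \<open>Half the radius: each cell then lies in the \<open>d\<close>-ball about any of
    its points, not only about its original tag, so it may be retagged freely.\<close>
  have "gauge (\<lambda>x::'a. ball x (d/2))"
    using \<open>0 < d\<close> by (intro gauge_ball) auto
  then obtain q where q: "q tagged_division_of cbox a b" "(\<lambda>x. ball x (d/2)) fine q"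
    using fine_division_exists by blast
  define \<D> where "\<D> = snd ` q"
  have D: "\<D> division_of cbox a b"
    unfolding \<D>_def by (rule division_of_tagged_division[OF q(1)])
  have close: "K \<subseteq> ball x d" if "K \<in> \<D>" "x \<in> K" for K x
  proof -
    obtain t where "(t, K) \<in> q"
      using \<open>K \<in> \<D>\<close> by (force simp: \<D>_def)
    then have K: "K \<subseteq> ball t (d/2)"
      using q(2) by (auto simp: fine_def)
    show ?thesis
    proof
      fix y assume "y \<in> K"
      then have "dist t y < d/2" "dist t x < d/2"
        using K that(2) by auto
      then show "y \<in> ball x d"
        using dist_triangle_half_r[of t x d y] by (auto simp: dist_commute)
    qed
  qed
  have near: "\<bar>(\<Sum>K\<in>\<D>. measure lborel K * g (x K)) - I\<bar> < e / 2" if x: "\<And>K. K \<in> \<D> \<Longrightarrow> x K \<in> K" for x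
  proof -
    let ?p = "(\<lambda>K. (x K, K)) ` \<D>"
    have "?p tagged_division_of cbox a b"
    proof (rule tagged_division_ofI)
      show "\<Union>{K. \<exists>t. (t, K) \<in> ?p} = cbox a b"
        using division_ofD(6)[OF D] by (auto simp: image_iff)
      show "interior K1 \<inter> interior K2 = {}" if "(x1, K1) \<in> ?p" "(x2, K2) \<in> ?p" "(x1, K1) \<noteq> (x2, K2)"
        for x1 K1 x2 K2
        using division_ofD(5)[OF D, of K1 K2] that by auto
    qed (use division_ofD[OF D] x in auto)
    moreover have "(\<lambda>x. ball x d) fine ?p"
      using close x by (auto simp: fine_def)
    ultimately have "\<bar>(\<Sum>(x, K)\<in>?p. measure lborel K * g x) - I\<bar> < e / 2"
      by (rule d)
    moreover have "inj_on (\<lambda>K. (x K, K)) \<D>"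
      by (auto intro: inj_onI)
    ultimately show ?thesis
      by (simp add: sum.reindex)
  qed
  show thesis
  proof (rule that[OF D])
    fix x y :: "'a set \<Rightarrow> 'a" assume xy: "\<And>K. K \<in> \<D> \<Longrightarrow> x K \<in> K \<and> y K \<in> K"
    have "\<bar>(\<Sum>K\<in>\<D>. measure lborel K * g (x K)) - I\<bar> < e / 2" "\<bar>(\<Sum>K\<in>\<D>. measure lborel K * g (y K)) - I\<bar> < e / 2"
      using near xy by blast+
    then have "(\<Sum>K\<in>\<D>. measure lborel K * g (x K)) - (\<Sum>K\<in>\<D>. measure lborel K * g (y K)) < e"
      unfolding abs_less_iff by linarith
    then show "(\<Sum>K\<in>\<D>. measure lborel K * (g (x K) - g (y K))) < e"
      by (simp add: right_diff_distrib sum_subtractf)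
  qed
qed

text \<open>Moving the tag in a single cell changes the Riemann sum by the volume of the cell times
  the change of \<open>g\<close>, so \<open>g\<close> has bounded oscillation on every cell of
  positive volume, and finitely many such cells cover the box.\<close>

lemma riemann_integrable_cbox_bounded:
  fixes g :: "'a::euclidean_space \<Rightarrow> real"
  assumes g: "riemann_integrable_cbox g a b" and ne: "measure lborel (cbox a b) \<noteq> 0"
  shows "bounded (g ` cbox a b)"
proof -
  obtain \<D> where D: "\<D> division_of cbox a b"
    and osc: "\<And>x y. (\<And>K. K \<in> \<D> \<Longrightarrow> x K \<in> K \<and> y K \<in> K) \<Longrightarrow>
       (\<Sum>K\<in>\<D>. measure lborel K * (g (x K) - g (y K))) < 1"
    using riemann_integrable_cbox_cells[OF g zero_less_one] by blast
  have fin: "finite \<D>"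
    using D by auto
  \<comment> \<open>A cell of volume zero gives no control of \<open>g\<close>, but dropping such
    cells still leaves a division of the box.\<close>
  let ?E = "{K \<in> \<D>. measure lborel K \<noteq> 0}"
  have E: "?E division_of cbox a b"
    by (rule division_of_nontrivial[OF D ne])
  have bdd: "bounded (g ` K)" if K: "K \<in> ?E" for K
  proof -
    have pos: "0 < measure lborel K"
      using K by (simp add: less_le)
    obtain y where y: "y \<in> K"
      using K division_ofD(3)[OF D] by blast
    have diff: "g u - g v < 1 / measure lborel K" if uv: "u \<in> K" "v \<in> K" for u v
    proof -
      define c where "c L = (SOME x. x \<in> L)" for L :: "'a set"
      have c: "c L \<in> L" if "L \<in> \<D>" for L
        using division_ofD(3)[OF D that] unfolding c_def by (metis some_in_eq)
      \<comment> \<open>The two tag choices agree outside \<open>K\<close>, so every other term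
        vanishes.\<close>
      have "(\<Sum>L\<in>\<D>. measure lborel L * (g ((c(K := u)) L) - g ((c(K := v)) L))) < 1"
        by (rule osc) (use c uv in auto)
      moreover have "(\<Sum>L\<in>\<D>. measure lborel L * (g ((c(K := u)) L) - g ((c(K := v)) L))) =
          measure lborel K * (g u - g v)"
        using K fin by (subst sum.remove[of _ K]) (auto intro!: sum.neutral)
      ultimately show ?thesis
        using pos by (simp add: field_simps)
    qed
    show ?thesis
      unfolding bounded_iff
    proof (intro exI ballI)
      fix w assume "w \<in> g ` K"
      then obtain u where "u \<in> K" "w = g u" by auto
      then show "norm w \<le> \<bar>g y\<bar> + 1 / measure lborel K"
        using diff[of u y] diff[of y u] y by auto
    qed
  qed
  have "g ` cbox a b = (\<Union>K\<in>?E. g ` K)"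
    using division_ofD(6)[OF E] by blast
  then show ?thesis
    using bdd fin by (auto intro!: bounded_Union)
qed

text \<open>The main half of Lebesgue's criterion. Cells on which \<open>g\<close> varies by more
  than \<open>c\<close> have total volume below \<open>e\<close>, since each contributes at least
  \<open>c\<close> times its volume to a sum smaller than \<open>c * e\<close>. A point of large
  oscillation lies in such a cell or on the frontier of some cell.\<close>

lemma riemann_integrable_cbox_negligible_oscillation:
  fixes g :: "'a::euclidean_space \<Rightarrow> real"
  assumes g: "riemann_integrable_cbox g a b" and "0 < c"
  shows "negligible {w \<in> cbox a b. \<forall>d>0. \<exists>x\<in>ball w d. \<exists>y\<in>ball w d. c < g x - g y}"
    (is "negligible ?S")
  unfolding negligible_outer_le
proof (intro allI impI)
  fix e :: real assume "0 < e"
  then have "0 < c * e" using \<open>0 < c\<close> by simp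
  then obtain \<D> where D: "\<D> division_of cbox a b"
    and osc: "\<And>x y. (\<And>K. K \<in> \<D> \<Longrightarrow> x K \<in> K \<and> y K \<in> K) \<Longrightarrow>
       (\<Sum>K\<in>\<D>. measure lborel K * (g (x K) - g (y K))) < c * e"
    using riemann_integrable_cbox_cells[OF g] by blast
  have fin: "finite \<D>"
    using D by auto
  define bad where "bad K \<longleftrightarrow> (\<exists>x\<in>K. \<exists>y\<in>K. c < g x - g y)" for K
  define \<B> where "\<B> = {K \<in> \<D>. bad K}"
  have BD: "\<B> \<subseteq> \<D>" by (auto simp: \<B>_def)
  \<comment> \<open>Tags realise the large variation in bad cells and give difference zero in the
    others, so only bad cells enter the sum.\<close>
  have "\<exists>x y. x \<in> K \<and> y \<in> K \<and> (if bad K then c \<le> g x - g y else g x = g y)" if "K \<in> \<D>" for K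
  proof (cases "bad K")
    case True
    then show ?thesis by (auto simp: bad_def intro: less_imp_le)
  next
    case False
    then show ?thesis using division_ofD(3)[OF D that] by auto
  qed
  then obtain x y where xy: "\<And>K. K \<in> \<D> \<Longrightarrow> x K \<in> K \<and> y K \<in> K \<and>
      (if bad K then c \<le> g (x K) - g (y K) else g (x K) = g (y K))"
    by metis
  have "c * (\<Sum>K\<in>\<B>. measure lborel K) = (\<Sum>K\<in>\<D>. measure lborel K * (if bad K then c else 0))"
    using fin by (simp add: \<B>_def sum_distrib_left sum.If_cases Int_def if_distrib mult.commute
        cong: if_cong)
  also have "\<dots> \<le> (\<Sum>K\<in>\<D>. measure lborel K * (g (x K) - g (y K)))"
  proof (intro sum_mono mult_left_mono)
    fix K assume "K \<in> \<D>"
    then show "(if bad K then c else 0) \<le> g (x K) - g (y K)"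
      using xy[of K] by (auto split: if_splits)
  qed auto
  also have "\<dots> < c * e"
    by (rule osc) (use xy in blast)
  finally have small: "(\<Sum>K\<in>\<B>. measure lborel K) < e"
    using \<open>0 < c\<close> by simp
  define N where "N = (\<Union>K\<in>\<D>. frontier K)"
  have box: "\<exists>u v. K = cbox u v" if "K \<in> \<D>" for K
    using division_ofD(4)[OF D that] .
  have N: "negligible N"
    unfolding N_def using fin box
    by (intro negligible_Union) (auto intro!: negligible_convex_frontier dest!: box)
  have UB: "\<Union>\<B> \<in> lmeasurable"
    using fin box BD by (intro fmeasurable.finite_Union) (auto dest: finite_subset)
  show "\<exists>T. ?S \<subseteq> T \<and> T \<in> lmeasurable \<and> measure lebesgue T \<le> e"
  proof (intro exI conjI)
    show "?S \<subseteq> \<Union>\<B> \<union> N"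
    proof
      fix w assume w: "w \<in> ?S"
      then have "w \<in> \<Union>\<D>"
        using division_ofD(6)[OF D] by auto
      then obtain K where K: "K \<in> \<D>" "w \<in> K" by auto
      show "w \<in> \<Union>\<B> \<union> N"
      proof (cases "w \<in> interior K")
        case True
        then obtain d where "0 < d" "ball w d \<subseteq> K"
          by (auto simp: mem_interior)
        then have "bad K"
          using w unfolding bad_def by blast
        then show ?thesis
          using K by (auto simp: \<B>_def)
      next
        case False
        then show ?thesis
          using K closure_subset by (force simp: N_def frontier_def)
      qed
    qed
    show "\<Union>\<B> \<union> N \<in> lmeasurable"
      using fmeasurable.Un[OF UB negligible_imp_measurable[OF N]] .
    have "measure lebesgue (\<Union>\<B> \<union> N) \<le> measure lebesgue (\<Union>\<B>) + measure lebesgue N"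
      using fmeasurableD[OF UB] fmeasurableD[OF negligible_imp_measurable[OF N]] by (rule measure_Un_le)
    also have "\<dots> = measure lebesgue (\<Union>\<B>)"
      using N by (simp add: negligible_imp_measure0)
    also have "\<dots> \<le> (\<Sum>K\<in>\<B>. measure lebesgue K)"
      using finite_subset[OF BD fin] box BD
      by (intro measure_Union_le) (auto dest!: subsetD box)
    also have "\<dots> = (\<Sum>K\<in>\<B>. measure lborel K)"
      using box BD by (intro sum.cong refl) (auto dest!: subsetD box)
    finally show "measure lebesgue (\<Union>\<B> \<union> N) \<le> e"
      using small by simp
  qed
qed

text \<open>A point of discontinuity has oscillation above \<open>1 / Suc n\<close> for some
  \<open>n\<close>, so countably many negligible sets cover all of them.\<close>

lemma riemann_integrable_cbox_negligible_discont:
  fixes g :: "'a::euclidean_space \<Rightarrow> real"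
  assumes g: "riemann_integrable_cbox g a b"
  shows "negligible {w \<in> cbox a b. \<not> isCont g w}"
proof -
  let ?S = "\<lambda>n. {w \<in> cbox a b. \<forall>d>0. \<exists>x\<in>ball w d. \<exists>y\<in>ball w d. 1 / real (Suc n) < g x - g y}"
  have "negligible (\<Union>n. ?S n)"
    by (intro negligible_Union_nat riemann_integrable_cbox_negligible_oscillation[OF g]) simp
  moreover have "{w \<in> cbox a b. \<not> isCont g w} \<subseteq> (\<Union>n. ?S n)"
  proof clarify
    fix w assume w: "w \<in> cbox a b" "\<not> isCont g w"
    then obtain e where e: "0 < e" "\<And>d. 0 < d \<Longrightarrow> \<exists>x. dist x w < d \<and> e \<le> dist (g x) (g w)"
      unfolding continuous_at_eps_delta by (metis not_less)
    obtain n where n: "1 / real (Suc n) < e"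
      using nat_approx_posE[OF e(1)] by blast
    have "\<exists>x\<in>ball w d. \<exists>y\<in>ball w d. 1 / real (Suc n) < g x - g y" if "0 < d" for d :: real
    proof -
      obtain x where x: "dist x w < d" "e \<le> \<bar>g x - g w\<bar>"
        using e(2)[OF \<open>0 < d\<close>] by (auto simp: dist_real_def)
      have "1 / real (Suc n) < g x - g w \<or> 1 / real (Suc n) < g w - g x"
        using x(2) n by linarith
      moreover have "x \<in> ball w d" "w \<in> ball w d"
        using x(1) \<open>0 < d\<close> by (auto simp: dist_commute)
      ultimately show ?thesis by blast
    qed
    then show "w \<in> (\<Union>n. ?S n)"
      using w(1) by blast
  qed
  ultimately show ?thesis
    by (rule negligible_subset)
qed

text \<open>Needed for the bump function in the converse direction. Uniform continuity supplies a
  constant gauge, and the error is estimated cell by cell.\<close>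

lemma continuous_imp_riemann_integrable_cbox:
  fixes g :: "'a::euclidean_space \<Rightarrow> real"
  assumes g: "continuous_on (cbox a b) g"
  shows "riemann_integrable_cbox g a b"
  unfolding riemann_integrable_cbox_def
proof (rule exI, intro allI impI)
  fix e :: real assume "0 < e"
  \<comment> \<open>The \<open>+ 1\<close> keeps the denominator positive even for a degenerate
    box.\<close>
  define \<eta> where "\<eta> = e / (measure lborel (cbox a b) + 1)"
  have pos: "0 < measure lborel (cbox a b) + 1"
    by (simp add: add_nonneg_pos)
  then have "0 < \<eta>"
    using \<open>0 < e\<close> by (simp add: \<eta>_def)
  have "uniformly_continuous_on (cbox a b) g"
    by (rule compact_uniformly_continuous[OF g compact_cbox])
  then obtain d where "0 < d" and d: "\<And>x y. x \<in> cbox a b \<Longrightarrow> y \<in> cbox a b \<Longrightarrow> dist y x < d \<Longrightarrow>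
      dist (g y) (g x) < \<eta>"
    using \<open>0 < \<eta>\<close> unfolding uniformly_continuous_on_def by metis
  show "\<exists>d>0. \<forall>p. p tagged_division_of cbox a b \<and> (\<lambda>x. ball x d) fine p \<longrightarrow>
      \<bar>(\<Sum>(x, K)\<in>p. measure lborel K * g x) - integral (cbox a b) g\<bar> < e"
  proof (intro exI[of _ d] conjI allI impI \<open>0 < d\<close>)
    fix p assume "p tagged_division_of cbox a b \<and> (\<lambda>x. ball x d) fine p"
    then have p: "p tagged_division_of cbox a b" and fine: "(\<lambda>x. ball x d) fine p" by auto
    have int: "g integrable_on cbox a b"
      by (rule integrable_continuous[OF g])
    have cell: "\<bar>measure lborel K * g x - integral K g\<bar> \<le> measure lborel K * \<eta>" if xK: "(x, K) \<in> p" for x K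
    proof -
      have K: "x \<in> K" "K \<subseteq> cbox a b" "K \<subseteq> ball x d"
        using tagged_division_ofD(2,3)[OF p xK] fine xK by (auto simp: fine_def)
      obtain u v where uv: "K = cbox u v"
        using tagged_division_ofD(4)[OF p xK] by blast
      have gK: "(g has_integral integral K g) (cbox u v)"
        using integrable_on_subcbox[OF int, of u v] K(2) uv by (auto intro: integrable_integral)
      have "((\<lambda>y. g x - g y) has_integral measure lborel K * g x - integral K g) (cbox u v)"
        using has_integral_diff[OF has_integral_const[of "g x" u v] gK] uv by simp
      then have "norm (measure lborel K * g x - integral K g) \<le> \<eta> * measure lborel (cbox u v)"
      proof (rule has_integral_bound[rotated])
        fix y assume "y \<in> cbox u v"
        then have "dist (g y) (g x) < \<eta>"
          using K uv by (intro d) (auto simp: dist_commute)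
        then show "norm (g x - g y) \<le> \<eta>"
          by (simp add: dist_norm norm_minus_commute)
      qed (use \<open>0 < \<eta>\<close> in simp)
      then show ?thesis
        by (simp add: uv mult.commute)
    qed
    have "\<bar>(\<Sum>(x, K)\<in>p. measure lborel K * g x) - integral (cbox a b) g\<bar> =
        \<bar>\<Sum>(x, K)\<in>p. measure lborel K * g x - integral K g\<bar>"
      by (simp add: integral_combine_tagged_division_topdown[OF int p] sum_subtractf split_def)
    also have "\<dots> \<le> (\<Sum>(x, K)\<in>p. measure lborel K * \<eta>)"
      using cell by (intro sum_abs[THEN order_trans] sum_mono) auto
    also have "\<dots> = measure lborel (cbox a b) * \<eta>"
      using additive_content_tagged_division[OF p]
      by (simp add: split_def flip: sum_distrib_right)
    also have "\<dots> < (measure lborel (cbox a b) + 1) * \<eta>"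
      using \<open>0 < \<eta>\<close> by simp
    also have "\<dots> = e"
      using pos by (simp add: \<eta>_def)
    finally show "\<bar>(\<Sum>(x, K)\<in>p. measure lborel K * g x) - integral (cbox a b) g\<bar> < e" .
  qed
qed

subsection \<open>Lipschitz majorants\<close>

text \<open>For bounded \<open>f\<close> and \<open>k \<ge> 0\<close> this is the least
  \<open>k\<close>-Lipschitz function above \<open>f\<close>, a Pasch-Hausdorff envelope.\<close>

definition sup_convolution :: "('a::metric_space \<Rightarrow> real) \<Rightarrow> real \<Rightarrow> 'a \<Rightarrow> real" where
  "sup_convolution f k w = (SUP v. f v - k * dist v w)"

context
  fixes f :: "'a::metric_space \<Rightarrow> real" and B k :: real
  assumes bound: "\<And>x. \<bar>f x\<bar> \<le> B" and k: "0 \<le> k"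
begin

lemma sup_convolution_bdd_above: "bdd_above (range (\<lambda>v. f v - k * dist v w))"
proof (rule bdd_aboveI2)
  fix v show "f v - k * dist v w \<le> B"
    using bound[of v] mult_nonneg_nonneg[OF k zero_le_dist[of v w]] by linarith
qed

lemma sup_convolution_upper: "f v - k * dist v w \<le> sup_convolution f k w"
  unfolding sup_convolution_def by (rule cSUP_upper[OF _ sup_convolution_bdd_above]) simp

lemma sup_convolution_ge: "f w \<le> sup_convolution f k w"
  using sup_convolution_upper[of w w] by simp

lemma sup_convolution_leI: "(\<And>v. f v - k * dist v w \<le> c) \<Longrightarrow> sup_convolution f k w \<le> c"
  unfolding sup_convolution_def by (rule cSUP_least) auto

lemma abs_sup_convolution_le: "\<bar>sup_convolution f k w\<bar> \<le> B"
proof -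
  have "sup_convolution f k w \<le> B"
    by (rule sup_convolution_leI)
      (use bound k in \<open>smt (verit) mult_nonneg_nonneg zero_le_dist\<close>)
  moreover have "- B \<le> sup_convolution f k w"
    using sup_convolution_ge[of w] bound[of w] by linarith
  ultimately show ?thesis by simp
qed

lemma sup_convolution_lipschitz: "k-lipschitz_on UNIV (sup_convolution f k)"
proof (rule lipschitz_onI[OF _ k])
  have "sup_convolution f k x \<le> sup_convolution f k y + k * dist x y" for x y
  proof (rule sup_convolution_leI)
    fix v
    have "k * dist v y \<le> k * (dist v x + dist x y)"
      by (intro mult_left_mono k dist_triangle)
    then show "f v - k * dist v x \<le> sup_convolution f k y + k * dist x y"
      using sup_convolution_upper[of v y] by (simp add: distrib_left)
  qed
  note le = this
  show "dist (sup_convolution f k x) (sup_convolution f k y) \<le> k * dist x y" for x y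
    using le[of x y] le[of y x] by (simp add: dist_real_def dist_commute abs_le_iff)
qed

end

text \<open>Points near \<open>w\<close> have values close to \<open>f w\<close> by continuity;
  points at distance at least \<open>d\<close> are penalised by at least \<open>n * d\<close>, which
  outweighs the largest possible gain \<open>2 * B\<close> once \<open>n\<close> is large.\<close>

lemma sup_convolution_tendsto:
  fixes f :: "'a::metric_space \<Rightarrow> real"
  assumes bound: "\<And>x. \<bar>f x\<bar> \<le> B" and cont: "isCont f w"
  shows "(\<lambda>n. sup_convolution f (real n) w) \<longlonglongrightarrow> f w"
proof (rule LIMSEQ_I)
  fix e :: real assume "0 < e"
  then obtain d where "0 < d" and d: "\<And>v. dist v w < d \<Longrightarrow> \<bar>f v - f w\<bar> < e / 2"
    using cont unfolding continuous_at_eps_delta dist_real_def by (meson half_gt_zero)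
  obtain N :: nat where N: "2 * B / d < real N"
    using reals_Archimedean2 by blast
  show "\<exists>N. \<forall>n\<ge>N. norm (sup_convolution f (real n) w - f w) < e"
  proof (intro exI allI impI)
    fix n assume "N \<le> n"
    then have n: "2 * B \<le> real n * d"
      using N \<open>0 < d\<close> by (smt (verit) of_nat_le_iff pos_divide_less_eq mult_right_mono)
    have "f v - real n * dist v w \<le> f w + e / 2" for v
    proof (cases "dist v w < d")
      case True
      then have "f v < f w + e / 2" using d[of v] by linarith
      then show ?thesis
        by (smt (verit) mult_nonneg_nonneg of_nat_0_le_iff zero_le_dist)
    next
      case False
      then have "real n * d \<le> real n * dist v w"
        by (intro mult_left_mono) auto
      then show ?thesis
        using n bound[of v] bound[of w] \<open>0 < e\<close> by linarith
    qed
    then have "sup_convolution f (real n) w \<le> f w + e / 2"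
      by (intro sup_convolution_leI[OF bound]) auto
    moreover have "f w \<le> sup_convolution f (real n) w"
      by (intro sup_convolution_ge[OF bound]) auto
    ultimately show "norm (sup_convolution f (real n) w - f w) < e"
      using \<open>0 < e\<close> by simp
  qed
qed

subsection \<open>Integration\<close>

text \<open>The fundamental domain is shifted by \<open>v\<close> and the part sticking out is moved back by \<open>d\<close>.\<close>

lemma lborel_integral_periodic_shift:
  fixes g :: "'a::euclidean_space \<Rightarrow> 'b::{banach, second_countable_topology}" and c :: "'a \<Rightarrow> real"
  assumes [measurable]: "c \<in> borel_measurable borel" "Measurable.pred borel C" "g \<in> borel_measurable borel"
    and fin: "emeasure lborel {w. 0 \<le> c w \<and> c w < 1 \<and> C w} < \<infinity>"
    and bound: "\<And>w. norm (g w) \<le> B"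
    and v: "\<And>w. c (w + v) = c w + r" "\<And>w. C (w + v) = C w" and r: "0 \<le> r" "r < 1"
    and d: "\<And>w. c (w + d) = c w + 1" "\<And>w. C (w + d) = C w" and g: "\<And>w. g (w + d) = g w"
  defines "P \<equiv> {w. 0 \<le> c w \<and> c w < 1 \<and> C w}"
  shows "(LINT w|lborel. indicat_real P w *\<^sub>R g (w + v)) = (LINT w|lborel. indicat_real P w *\<^sub>R g w)"
proof -
  \<comment> \<open>In the intended use \<open>c\<close> is one lattice coordinate and
    \<open>C\<close> restricts the other. Translating \<open>P\<close> by \<open>v\<close> gives the
    slab \<open>r \<le> c < 1 + r\<close>, which splits at \<open>c = 1\<close> into
    \<open>B'\<close> and the translate of \<open>A\<close> by \<open>d\<close>.\<close>
  define A where "A = {w. 0 \<le> c w \<and> c w < r \<and> C w}"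
  define B' where "B' = {w. r \<le> c w \<and> c w < 1 \<and> C w}"
  have [measurable]: "P \<in> sets borel" "A \<in> sets borel" "B' \<in> sets borel"
    unfolding P_def A_def B'_def by measurable
  have shift: "(LINT w|lborel. f w) = (LINT w|lborel. f (t + w))"
    if [measurable]: "f \<in> borel_measurable borel" for f :: "'a \<Rightarrow> 'b" and t
  proof -
    have "(LINT w|lborel. f w) = (LINT w|distr lborel borel ((+) t). f w)"
      by (simp add: lborel_distr_plus)
    also have "\<dots> = (LINT w|lborel. f (t + w))"
      by (rule integral_distr) auto
    finally show ?thesis .
  qed
  have int: "integrable lborel (\<lambda>w. indicat_real X w *\<^sub>R g w)"
    if [measurable]: "X \<in> sets borel" and "X \<subseteq> P" for X
  proof (rule Bochner_Integration.integrable_bound[where f = "\<lambda>w. B * indicat_real P w"])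
    show "integrable lborel (\<lambda>w. B * indicat_real P w)"
      using fin by (intro integrable_mult_right integrable_real_indicator) (auto simp: P_def)
    show "AE w in lborel. norm (indicat_real X w *\<^sub>R g w) \<le> norm (B * indicat_real P w)"
      using \<open>X \<subseteq> P\<close> bound by (intro AE_I2) (auto simp: indicator_def intro: order_trans[OF _ abs_ge_self])
  qed simp
  have intA: "integrable lborel (\<lambda>w. indicat_real A w *\<^sub>R g w)"
    and intB: "integrable lborel (\<lambda>w. indicat_real B' w *\<^sub>R g w)"
    using r by (intro int; force simp: A_def B'_def P_def)+
  have moved: "(LINT w|lborel. indicat_real A (w - d) *\<^sub>R g w) = (LINT w|lborel. indicat_real A w *\<^sub>R g w)"
    by (subst shift[where t = d]) (simp_all add: g add.commute[of d])
  have int_moved: "integrable lborel (\<lambda>w. indicat_real A (w - d) *\<^sub>R g w)"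
  proof -
    have "integrable (distr lborel borel ((+) d)) (\<lambda>w. indicat_real A (w - d) *\<^sub>R g w)"
      using intA by (subst integrable_distr_eq) (auto simp: g add.commute[of d])
    then show ?thesis by (simp add: lborel_distr_plus)
  qed
  have cm: "c (w - v) = c w - r" "C (w - v) = C w" "c (w - d) = c w - 1" "C (w - d) = C w" for w
    using v[of "w - v"] d[of "w - d"] by simp_all
  have "(LINT w|lborel. indicat_real P w *\<^sub>R g (w + v)) =
      (LINT w|lborel. indicat_real P (w - v) *\<^sub>R g w)"
    by (subst shift[where t = v and f = "\<lambda>w. indicat_real P (w - v) *\<^sub>R g w"])
      (simp_all add: add.commute[of v])
  also have "\<dots> = (LINT w|lborel. indicat_real B' w *\<^sub>R g w + indicat_real A (w - d) *\<^sub>R g w)"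
    using r by (intro Bochner_Integration.integral_cong refl)
      (auto simp: P_def A_def B'_def cm indicator_def)
  also have "\<dots> = (LINT w|lborel. indicat_real B' w *\<^sub>R g w) + (LINT w|lborel. indicat_real A w *\<^sub>R g w)"
    by (simp only: Bochner_Integration.integral_add[OF intB int_moved] moved)
  also have "\<dots> = (LINT w|lborel. indicat_real B' w *\<^sub>R g w + indicat_real A w *\<^sub>R g w)"
    by (rule Bochner_Integration.integral_add[OF intB intA, symmetric])
  also have "\<dots> = (LINT w|lborel. indicat_real P w *\<^sub>R g w)"
    using r by (intro Bochner_Integration.integral_cong refl)
      (auto simp: P_def A_def B'_def indicator_def)
  finally show ?thesis .
qed

text \<open>For Borel functions the integral over the completed, normalised measure reduces to
  \<open>lborel\<close>, where translation invariance is at hand.\<close>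

lemma integral_uniform_measure_lebesgue:
  fixes g :: "'a::euclidean_space \<Rightarrow> 'b::{banach, second_countable_topology}"
  assumes [measurable]: "g \<in> borel_measurable borel" and P: "P \<in> sets borel"
    and "emeasure lborel P \<noteq> 0" "emeasure lborel P \<noteq> \<infinity>"
  shows "(LINT w|uniform_measure lebesgue P. g w) =
    (1 / measure lborel P) *\<^sub>R (LINT w|lborel. indicat_real P w *\<^sub>R g w)"
proof -
  have [measurable]: "P \<in> sets lebesgue" "g \<in> borel_measurable lebesgue"
    using P assms(1) by (auto simp: measurable_completion)
  have pos: "0 < measure lborel P"
    using assms(3,4) by (simp add: emeasure_eq_ennreal_measure zero_less_measure_iff)
  have "indicator P w / emeasure lebesgue P = ennreal (indicat_real P w / measure lborel P)" for w
  proof -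
    have "emeasure lebesgue P = ennreal (measure lborel P)"
      using assms(4) P by (simp add: emeasure_eq_ennreal_measure)
    then show ?thesis
      using pos by (simp add: divide_ennreal flip: ennreal_indicator)
  qed
  then have "uniform_measure lebesgue P = density lebesgue (\<lambda>w. indicat_real P w / measure lborel P)"
    by (simp add: uniform_measure_def)
  then have "(LINT w|uniform_measure lebesgue P. g w) =
      (LINT w|lebesgue. (indicat_real P w / measure lborel P) *\<^sub>R g w)"
    using pos by (simp add: integral_density)
  also have "\<dots> = (LINT w|lborel. (indicat_real P w / measure lborel P) *\<^sub>R g w)"
    using P by (intro integral_completion) simp
  also have "\<dots> = (LINT w|lborel. (1 / measure lborel P) *\<^sub>R (indicat_real P w *\<^sub>R g w))"
    by (intro Bochner_Integration.integral_cong) auto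
  finally show ?thesis
    by (simp only: integral_scaleR_right)
qed

text \<open>A continuous map from a compact space to a Hausdorff space is a quotient map onto its
  image, so a function on the image is continuous as soon as its pullback is.\<close>

lemma continuous_on_factor_compact:
  fixes p :: "'a::t2_space \<Rightarrow> 'b::t2_space" and g :: "'a \<Rightarrow> 'c::topological_space"
  assumes Q: "compact Q" and p: "continuous_on Q p" and g: "continuous_on Q g"
    and h: "\<And>x. x \<in> Q \<Longrightarrow> h (p x) = g x"
  shows "continuous_on (p ` Q) h"
  unfolding continuous_openin_preimage_eq
proof (intro allI impI)
  fix U :: "'c set" assume "open U"
  have "Q \<inter> p -` (p ` Q \<inter> h -` U) = Q \<inter> g -` U"
    by (auto simp: h) (metis h)
  moreover have "openin (top_of_set Q) (Q \<inter> g -` U)"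
    using continuous_openin_preimage_gen[OF g \<open>open U\<close>] .
  ultimately show "openin (top_of_set (p ` Q)) (p ` Q \<inter> h -` U)"
    using Abstract_Topology_2.continuous_imp_quotient_map[OF p refl Q, of "p ` Q \<inter> h -` U"] by simp
qed

text \<open>The function is continuous, hence measurable, on the complement of a null set, and
  completeness of \<open>lebesgue\<close> absorbs the null set.\<close>

lemma borel_measurable_lebesgue_AE_continuous:
  fixes f :: "'a::euclidean_space \<Rightarrow> 'b::euclidean_space"
  assumes "negligible {w. \<not> isCont f w}"
  shows "f \<in> borel_measurable lebesgue"
proof -
  let ?N = "{w. \<not> isCont f w}"
  have N: "?N \<in> null_sets (lebesgue_on UNIV)"
    using assms by (simp add: negligible_iff_null_sets lebesgue_on_UNIV_eq)
  have "continuous_on (UNIV - ?N) f"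
    by (rule continuous_at_imp_continuous_on) simp
  moreover have "UNIV - ?N \<in> sets lebesgue"
    by (intro sets.Diff[OF _ negligible_imp_sets[OF assms]]) simp
  ultimately have "f \<in> borel_measurable (lebesgue_on (UNIV - ?N))"
    by (rule continuous_imp_measurable_on_sets_lebesgue)
  then show ?thesis
    using borel_measurable_diff_null[OF N, of f] by (simp add: lebesgue_on_UNIV_eq)
qed

text \<open>The geometric sums stay bounded by \<open>2 / norm (a - 1)\<close>, so dividing by
  \<open>N\<close> sends them to zero.\<close>

lemma tendsto_cesaro_power:
  fixes a :: complex
  assumes "norm a = 1" "a \<noteq> 1"
  shows "(\<lambda>N. (\<Sum>n<N. c * a ^ n) / of_nat N) \<longlonglongrightarrow> 0"
proof (rule Lim_null_comparison)
  let ?C = "norm c * (2 / norm (a - 1))"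
  show "(\<lambda>N. ?C / real N) \<longlonglongrightarrow> 0"
    by (rule lim_const_over_n)
  show "\<forall>\<^sub>F N in sequentially. norm ((\<Sum>n<N. c * a ^ n) / of_nat N) \<le> ?C / real N"
  proof (intro always_eventually allI)
    fix N
    have "norm (\<Sum>n<N. a ^ n) = norm (a ^ N - 1) / norm (a - 1)"
      using assms(2) by (simp add: geometric_sum norm_divide)
    also have "\<dots> \<le> 2 / norm (a - 1)"
      using norm_triangle_ineq4[of "a ^ N" 1] assms(1) by (intro divide_right_mono) (auto simp: norm_power)
    finally have "norm c * norm (\<Sum>n<N. a ^ n) \<le> ?C"
      by (intro mult_left_mono) auto
    then have "norm c * norm (\<Sum>n<N. a ^ n) / real N \<le> ?C / real N"
      by (intro divide_right_mono) auto
    then show "norm ((\<Sum>n<N. c * a ^ n) / of_nat N) \<le> ?C / real N"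
      by (simp only: norm_divide norm_mult norm_of_nat flip: sum_distrib_left)
  qed
qed

subsection \<open>Characters of the torus\<close>

text \<open>With \<open>lattice_snd\<close>, the real coordinates of \<open>w\<close> in the basis
  \<open>1\<close>, \<open>\<tau>\<close>. In them the lattice becomes the integer lattice and the
  parallelogram the half-open unit square.\<close>

definition lattice_fst :: "complex \<Rightarrow> complex \<Rightarrow> real" where
  "lattice_fst \<tau> w = Re w - Re \<tau> / Im \<tau> * Im w"

definition lattice_snd :: "complex \<Rightarrow> complex \<Rightarrow> real" where
  "lattice_snd \<tau> w = Im w / Im \<tau>"

text \<open>The characters of the torus. Expanding the coordinates shows that the real number
  multiplied by \<open>2 * pi\<close> is the one in the theorem, with \<open>m\<close>,
  \<open>n\<close> as its two integers.\<close>

definition torus_char :: "complex \<Rightarrow> int \<Rightarrow> int \<Rightarrow> complex \<Rightarrow> complex" where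
  "torus_char \<tau> m n w = cis (2 * pi * (of_int m * lattice_fst \<tau> w + of_int n * lattice_snd \<tau> w))"

definition lattice_periodic :: "complex \<Rightarrow> (complex \<Rightarrow> 'a) \<Rightarrow> bool" where
  "lattice_periodic \<tau> g \<longleftrightarrow> (\<forall>u v. v \<in> lattice \<tau> \<longrightarrow> g (u + v) = g u)"

lemma lattice_coords_add [simp]:
  "lattice_fst \<tau> (u + v) = lattice_fst \<tau> u + lattice_fst \<tau> v"
  "lattice_snd \<tau> (u + v) = lattice_snd \<tau> u + lattice_snd \<tau> v"
  "lattice_fst \<tau> (u - v) = lattice_fst \<tau> u - lattice_fst \<tau> v"
  "lattice_snd \<tau> (u - v) = lattice_snd \<tau> u - lattice_snd \<tau> v"
  by (simp_all add: lattice_fst_def lattice_snd_def algebra_simps add_divide_distrib diff_divide_distrib)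

lemma lattice_coords_zero [simp]: "lattice_fst \<tau> 0 = 0" "lattice_snd \<tau> 0 = 0"
  by (simp_all add: lattice_fst_def lattice_snd_def)

lemma continuous_on_lattice_coords [continuous_intros]:
  "continuous_on A f \<Longrightarrow> continuous_on A (\<lambda>x. lattice_fst \<tau> (f x))"
  "continuous_on A f \<Longrightarrow> continuous_on A (\<lambda>x. lattice_snd \<tau> (f x))"
  unfolding lattice_fst_def lattice_snd_def divide_inverse by (intro continuous_intros; assumption)+

lemma continuous_on_torus_char: "continuous_on A (torus_char \<tau> m n)"
  unfolding torus_char_def[abs_def] by (intro continuous_intros)

lemma norm_torus_char [simp]: "norm (torus_char \<tau> m n w) = 1"
  by (simp add: torus_char_def)

lemma torus_char_0 [simp]: "torus_char \<tau> 0 0 w = 1"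
  by (simp add: torus_char_def)

lemma torus_char_at_0 [simp]: "torus_char \<tau> m n 0 = 1"
  by (simp add: torus_char_def)

lemma torus_char_mult: "torus_char \<tau> m n w * torus_char \<tau> m' n' w = torus_char \<tau> (m + m') (n + n') w"
  by (simp add: torus_char_def cis_mult algebra_simps)

lemma torus_char_add: "torus_char \<tau> m n (u + v) = torus_char \<tau> m n u * torus_char \<tau> m n v"
  by (simp add: torus_char_def cis_mult algebra_simps)

lemma torus_char_multiple: "torus_char \<tau> m n (of_nat k * w) = torus_char \<tau> m n w ^ k"
  by (induction k) (simp_all add: torus_char_add distrib_right)

lemma cis_2pi_eq_1_iff: "cis (2 * pi * x) = 1 \<longleftrightarrow> x \<in> \<int>"
proof -
  have "cis (2 * pi * x) = exp (complex_of_real (2 * pi * x) * \<i>)"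
    by (simp add: cis_conv_exp mult.commute)
  then have "cis (2 * pi * x) = 1 \<longleftrightarrow> (\<exists>n::int. 2 * pi * x = of_int (2 * n) * pi)"
    by (simp add: exp_eq_1)
  also have "\<dots> \<longleftrightarrow> x \<in> \<int>"
    by (auto elim!: Ints_cases simp: Ints_def)
  finally show ?thesis .
qed

lemma torus_char_eq_1_iff:
  "torus_char \<tau> m n w = 1 \<longleftrightarrow> of_int m * lattice_fst \<tau> w + of_int n * lattice_snd \<tau> w \<in> \<int>"
  unfolding torus_char_def by (rule cis_2pi_eq_1_iff)

lemma uminus_in_lattice: "v \<in> lattice \<tau> \<Longrightarrow> - v \<in> lattice \<tau>"
proof -
  assume "v \<in> lattice \<tau>"
  then obtain m n :: int where "v = of_int m + of_int n * \<tau>"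
    by (auto simp: lattice_def)
  then have "- v = of_int (- m) + of_int (- n) * \<tau>" by simp
  then show ?thesis unfolding lattice_def by blast
qed

lemma countable_lattice: "countable (lattice \<tau>)"
proof -
  have "lattice \<tau> = (\<lambda>(m, n). of_int m + of_int n * \<tau>) ` (UNIV :: (int \<times> int) set)"
    by (auto simp: lattice_def)
  then show ?thesis by simp
qed

text \<open>Only sums are generated; closure under products is derived from the product rule for
  characters. Linear statements can thus be proved by induction from single characters.\<close>

inductive trig_poly :: "complex \<Rightarrow> (complex \<Rightarrow> complex) \<Rightarrow> bool" for \<tau> where
  monomial: "trig_poly \<tau> (\<lambda>w. c * torus_char \<tau> m n w)"
| add: "trig_poly \<tau> p \<Longrightarrow> trig_poly \<tau> q \<Longrightarrow> trig_poly \<tau> (\<lambda>w. p w + q w)"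

lemma trig_poly_const: "trig_poly \<tau> (\<lambda>w. c)"
  using trig_poly.monomial[of \<tau> c 0 0] by simp

lemma trig_poly_mult:
  assumes "trig_poly \<tau> p" "trig_poly \<tau> q"
  shows "trig_poly \<tau> (\<lambda>w. p w * q w)"
  using assms(1)
proof induction
  case (monomial c m n)
  show ?case
    using assms(2)
  proof induction
    case (monomial d m' n')
    have "(\<lambda>w. c * torus_char \<tau> m n w * (d * torus_char \<tau> m' n' w)) =
        (\<lambda>w. (c * d) * torus_char \<tau> (m + m') (n + n') w)"
      by (simp add: fun_eq_iff ac_simps flip: torus_char_mult)
    then show ?case
      by (simp only: trig_poly.monomial)
  next
    case (add p q)
    then show ?case by (simp add: distrib_left trig_poly.add)
  qed
next
  case (add p q)
  then show ?case by (simp add: distrib_right trig_poly.add)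
qed

lemma lattice_periodic_sup_convolution:
  assumes "lattice_periodic \<tau> f"
  shows "lattice_periodic \<tau> (sup_convolution f k)"
  unfolding lattice_periodic_def
proof (intro allI impI)
  fix u v assume v: "v \<in> lattice \<tau>"
  \<comment> \<open>The supremum is reindexed by the bijection \<open>x \<mapsto> x + v\<close>,
    which changes neither distances nor, by periodicity, the values of \<open>f\<close>.\<close>
  have "range (\<lambda>x. f x - k * dist x (u + v)) = range ((\<lambda>x. f x - k * dist x (u + v)) \<circ> (\<lambda>x. x + v))"
    unfolding image_comp[symmetric] surj_plus_right ..
  also have "(\<lambda>x. f x - k * dist x (u + v)) \<circ> (\<lambda>x. x + v) = (\<lambda>x. f x - k * dist x u)"
    using assms v by (auto simp: lattice_periodic_def fun_eq_iff)
  finally show "sup_convolution f k (u + v) = sup_convolution f k u"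
    unfolding sup_convolution_def by simp
qed

text \<open>With \<open>r = 1 / (2 * \<bar>k\<bar>)\<close> the product is \<open>1/2\<close> or
  \<open>-1/2\<close>. This provides translations, and points, at which a character is
  nontrivial.\<close>

lemma int_multiple_not_Ints:
  fixes k :: int
  assumes "k \<noteq> 0"
  obtains r :: real where "0 \<le> r" "r < 1" "of_int k * r \<notin> \<int>"
proof
  let ?r = "1 / (2 * \<bar>real_of_int k\<bar>)"
  have "1 \<le> \<bar>real_of_int k\<bar>"
    using assms by linarith
  then show "0 \<le> ?r" "?r < 1"
    by (auto simp: divide_simps)
  show "of_int k * ?r \<notin> \<int>"
  proof
    assume "of_int k * ?r \<in> \<int>"
    then obtain z where "of_int k * ?r = real_of_int z"
      by (rule Ints_cases)
    then have "\<bar>real_of_int k * ?r\<bar> = \<bar>real_of_int z\<bar>"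
      by simp
    moreover have "\<bar>real_of_int k * ?r\<bar> = 1 / 2"
      using assms by (simp add: abs_mult)
    ultimately have "2 * \<bar>z\<bar> = 1"
      by linarith
    then show False by presburger
  qed
qed

section \<open>Lattice coordinates and the fundamental parallelogram\<close>

context
  fixes \<tau> :: complex
  assumes \<tau>: "0 < Im \<tau>"
begin

lemma lattice_coords_eq:
  "lattice_fst \<tau> (of_real s + of_real t * \<tau>) = s" "lattice_snd \<tau> (of_real s + of_real t * \<tau>) = t"
  using \<tau> by (simp_all add: lattice_fst_def lattice_snd_def)

lemma lattice_coords_real_multiple [simp]:
  "lattice_fst \<tau> (of_real r) = r" "lattice_snd \<tau> (of_real r) = 0"
  "lattice_fst \<tau> (of_real r * \<tau>) = 0" "lattice_snd \<tau> (of_real r * \<tau>) = r"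
  using lattice_coords_eq[of r 0] lattice_coords_eq[of 0 r] by simp_all

lemma lattice_coords_expand: "of_real (lattice_fst \<tau> w) + of_real (lattice_snd \<tau> w) * \<tau> = w"
  using \<tau> by (simp add: complex_eq_iff lattice_fst_def lattice_snd_def)

lemma in_lattice_iff: "w \<in> lattice \<tau> \<longleftrightarrow> lattice_fst \<tau> w \<in> \<int> \<and> lattice_snd \<tau> w \<in> \<int>"
proof
  assume "w \<in> lattice \<tau>"
  then obtain m n :: int where "w = of_real (of_int m) + of_real (of_int n) * \<tau>"
    by (auto simp: lattice_def)
  then show "lattice_fst \<tau> w \<in> \<int> \<and> lattice_snd \<tau> w \<in> \<int>"
    by (simp only: lattice_coords_eq Ints_of_int simp_thms)
next
  assume "lattice_fst \<tau> w \<in> \<int> \<and> lattice_snd \<tau> w \<in> \<int>"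
  then obtain m n :: int where "lattice_fst \<tau> w = of_int m" "lattice_snd \<tau> w = of_int n"
    by (auto elim!: Ints_cases)
  then have "w = of_int m + of_int n * \<tau>"
    using lattice_coords_expand[of w] by simp
  then show "w \<in> lattice \<tau>"
    by (auto simp: lattice_def)
qed

lemma fundamental_parallelogram_eq:
  "fundamental_parallelogram \<tau> =
    {w. 0 \<le> lattice_fst \<tau> w \<and> lattice_fst \<tau> w < 1 \<and> 0 \<le> lattice_snd \<tau> w \<and> lattice_snd \<tau> w < 1}"
proof -
  have "\<exists>s t. w = of_real s + of_real t * \<tau> \<and> 0 \<le> s \<and> s < 1 \<and> 0 \<le> t \<and> t < 1"
    if "0 \<le> lattice_fst \<tau> w" "lattice_fst \<tau> w < 1" "0 \<le> lattice_snd \<tau> w" "lattice_snd \<tau> w < 1" for w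
    using that lattice_coords_expand[of w] by metis
  then show ?thesis
    unfolding fundamental_parallelogram_def by auto
qed

lemma lattice_translate_in_parallelogram:
  obtains v where "v \<in> lattice \<tau>" "w + v \<in> fundamental_parallelogram \<tau>"
proof -
  define v where "v = of_real (of_int (- \<lfloor>lattice_fst \<tau> w\<rfloor>)) + of_real (of_int (- \<lfloor>lattice_snd \<tau> w\<rfloor>)) * \<tau>"
  have v: "lattice_fst \<tau> v = - of_int \<lfloor>lattice_fst \<tau> w\<rfloor>" "lattice_snd \<tau> v = - of_int \<lfloor>lattice_snd \<tau> w\<rfloor>"
    unfolding v_def lattice_coords_eq by simp_all
  show thesis
  proof (rule that)
    show "v \<in> lattice \<tau>"
      by (simp add: in_lattice_iff v)
    show "w + v \<in> fundamental_parallelogram \<tau>"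
      unfolding fundamental_parallelogram_eq mem_Collect_eq lattice_coords_add v by linarith
  qed
qed

lemma torus_class_eq_iff: "torus_class \<tau> u = torus_class \<tau> v \<longleftrightarrow> u - v \<in> lattice \<tau>"
proof
  assume "torus_class \<tau> u = torus_class \<tau> v"
  moreover have "v \<in> torus_class \<tau> v"
    by (simp add: torus_class_def lattice_rel_def in_lattice_iff)
  ultimately have "v \<in> torus_class \<tau> u" by simp
  then show "u - v \<in> lattice \<tau>"
    by (simp add: torus_class_def lattice_rel_def)
next
  assume uv: "u - v \<in> lattice \<tau>"
  have "u - w \<in> lattice \<tau> \<longleftrightarrow> v - w \<in> lattice \<tau>" for w
  proof -
    have "u - w = (u - v) + (v - w)" by simp
    then show ?thesis
      using uv unfolding in_lattice_iff by (metis Ints_add Ints_diff add_diff_cancel_left' lattice_coords_add(1,2))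
  qed
  then show "torus_class \<tau> u = torus_class \<tau> v"
    by (auto simp: torus_class_def lattice_rel_def)
qed

lemma lattice_periodic_torus_class: "lattice_periodic \<tau> (\<lambda>w. f (torus_class \<tau> w))"
proof -
  have "torus_class \<tau> (u + v) = torus_class \<tau> u" if "v \<in> lattice \<tau>" for u v
    using that by (simp add: torus_class_eq_iff)
  then show ?thesis by (simp add: lattice_periodic_def)
qed

lemma lattice_periodic_torus_char: "lattice_periodic \<tau> (torus_char \<tau> m n)"
  unfolding lattice_periodic_def torus_char_add
  by (auto simp: torus_char_eq_1_iff in_lattice_iff)

lemma bounded_fundamental_parallelogram: "bounded (fundamental_parallelogram \<tau>)"
  unfolding bounded_iff
proof (intro exI ballI)
  fix w assume w: "w \<in> fundamental_parallelogram \<tau>"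
  have "norm w \<le> norm (complex_of_real (lattice_fst \<tau> w)) + norm (of_real (lattice_snd \<tau> w) * \<tau>)"
    by (subst (1) lattice_coords_expand[of w, symmetric]) (rule norm_triangle_ineq)
  also have "\<dots> \<le> 1 + 1 * norm \<tau>"
    using w unfolding fundamental_parallelogram_eq
    by (intro add_mono) (auto simp: norm_mult intro!: mult_left_le_one_le)
  finally show "norm w \<le> 1 + 1 * norm \<tau>" .
qed

lemma sets_fundamental_parallelogram [measurable]: "fundamental_parallelogram \<tau> \<in> sets borel"
proof -
  have [measurable]: "lattice_fst \<tau> \<in> borel_measurable borel" "lattice_snd \<tau> \<in> borel_measurable borel"
    by (intro borel_measurable_continuous_onI continuous_intros)+
  show ?thesis
    unfolding fundamental_parallelogram_eq by measurable
qed

lemma open_parallelogram_interior: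
  "open {w. 0 < lattice_fst \<tau> w \<and> lattice_fst \<tau> w < 1 \<and> 0 < lattice_snd \<tau> w \<and> lattice_snd \<tau> w < 1}"
  by (intro open_Collect_conj open_Collect_less continuous_intros)

text \<open>Convexity makes the frontier of the parallelogram negligible.\<close>

lemma convex_fundamental_parallelogram: "convex (fundamental_parallelogram \<tau>)"
proof -
  have lin: "linear (lattice_fst \<tau>)" "linear (lattice_snd \<tau>)"
    by (auto intro!: linearI simp: lattice_fst_def lattice_snd_def algebra_simps add_divide_distrib)
  have "fundamental_parallelogram \<tau> =
      lattice_fst \<tau> -` {0..<1} \<inter> lattice_snd \<tau> -` {0..<1}"
    unfolding fundamental_parallelogram_eq by auto
  then show ?thesis
    by (simp add: convex_Int convex_linear_vimage lin)
qed

lemma emeasure_fundamental_parallelogram: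
  "emeasure lborel (fundamental_parallelogram \<tau>) \<noteq> 0"
  "emeasure lborel (fundamental_parallelogram \<tau>) \<noteq> \<infinity>"
proof -
  let ?U = "{w. 0 < lattice_fst \<tau> w \<and> lattice_fst \<tau> w < 1 \<and> 0 < lattice_snd \<tau> w \<and> lattice_snd \<tau> w < 1}"
  have "complex_of_real (1/2) + of_real (1/2) * \<tau> \<in> ?U"
    unfolding mem_Collect_eq lattice_coords_eq by simp
  then have "\<not> negligible ?U"
    using open_not_negligible[OF open_parallelogram_interior] by blast
  moreover have "?U \<subseteq> fundamental_parallelogram \<tau>"
    by (auto simp: fundamental_parallelogram_eq)
  ultimately have "\<not> negligible (fundamental_parallelogram \<tau>)"
    using negligible_subset by blast
  then show "emeasure lborel (fundamental_parallelogram \<tau>) \<noteq> 0"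
    using sets_fundamental_parallelogram by (auto simp: negligible_iff_null_sets null_sets_def)
  show "emeasure lborel (fundamental_parallelogram \<tau>) \<noteq> \<infinity>"
    using emeasure_bounded_finite[OF bounded_fundamental_parallelogram] by simp
qed

section \<open>The normalised measure and the means of characters\<close>

abbreviation torus_measure :: "complex measure" where
  "torus_measure \<equiv> uniform_measure lebesgue (fundamental_parallelogram \<tau>)"

lemma measure_torus_UNIV: "measure torus_measure UNIV = 1"
  and finite_measure_torus: "finite_measure torus_measure"
proof -
  have "emeasure torus_measure UNIV = 1"
    using emeasure_fundamental_parallelogram sets_fundamental_parallelogram
    by (subst emeasure_uniform_measure) (auto intro!: ennreal_divide_self simp: top.not_eq_extremum)
  then show "measure torus_measure UNIV = 1" "finite_measure torus_measure"
    by (auto simp: measure_def intro!: finite_measureI)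
qed

text \<open>Translation by \<open>v\<close> preserves the integral of a periodic function, yet
  multiplies the integral of the character by its value at \<open>v\<close>. A \<open>v\<close>
  where this value is not \<open>1\<close> forces the integral to be zero.\<close>

lemma integral_torus_char:
  assumes "(m, n) \<noteq> (0, 0)"
  shows "(LINT w|torus_measure. torus_char \<tau> m n w) = 0"
proof -
  let ?P = "fundamental_parallelogram \<tau>" and ?I = "LINT w|torus_measure. torus_char \<tau> m n w"
  note torus = integral_uniform_measure_lebesgue[OF _ sets_fundamental_parallelogram
      emeasure_fundamental_parallelogram]
  have [measurable]: "torus_char \<tau> m n \<in> borel_measurable borel"
    by (intro borel_measurable_continuous_onI continuous_on_torus_char)
  have [measurable]: "lattice_fst \<tau> \<in> borel_measurable borel" "lattice_snd \<tau> \<in> borel_measurable borel"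
    by (intro borel_measurable_continuous_onI continuous_intros)+
  have per: "torus_char \<tau> m n (w + v) = torus_char \<tau> m n w" if "v \<in> lattice \<tau>" for w v
    using lattice_periodic_torus_char that by (auto simp: lattice_periodic_def)
  note one = lattice_coords_real_multiple(1,2)[of 1, simplified] lattice_coords_real_multiple(3,4)[of 1, simplified]
  obtain v where v: "torus_char \<tau> m n v \<noteq> 1"
    "(LINT w|lborel. indicat_real ?P w *\<^sub>R torus_char \<tau> m n (w + v)) =
       (LINT w|lborel. indicat_real ?P w *\<^sub>R torus_char \<tau> m n w)"
  \<comment> \<open>The translation goes along \<open>1\<close> if \<open>m \<noteq> 0\<close> and
    along \<open>\<tau>\<close> otherwise, so that it changes only the coordinate whose coefficient
    is known to be nonzero.\<close>
  proof (cases "m = 0")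
    case False
    obtain r :: real where r: "0 \<le> r" "r < 1" "of_int m * r \<notin> \<int>"
      using False by (rule int_multiple_not_Ints)
    have eq: "?P = {w. 0 \<le> lattice_fst \<tau> w \<and> lattice_fst \<tau> w < 1 \<and> (0 \<le> lattice_snd \<tau> w \<and> lattice_snd \<tau> w < 1)}"
      by (simp add: fundamental_parallelogram_eq)
    show thesis
    proof (rule that[of "of_real r"])
      show "torus_char \<tau> m n (of_real r) \<noteq> 1"
        using r by (simp add: torus_char_eq_1_iff lattice_coords_real_multiple)
      show "(LINT w|lborel. indicat_real ?P w *\<^sub>R torus_char \<tau> m n (w + of_real r)) =
         (LINT w|lborel. indicat_real ?P w *\<^sub>R torus_char \<tau> m n w)"
        unfolding eq
      proof (rule lborel_integral_periodic_shift[where r = r and d = 1 and B = 1])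
        show "torus_char \<tau> m n (w + 1) = torus_char \<tau> m n w" for w
          by (rule per) (simp add: in_lattice_iff one)
        show "emeasure lborel {w. 0 \<le> lattice_fst \<tau> w \<and> lattice_fst \<tau> w < 1 \<and> 0 \<le> lattice_snd \<tau> w \<and> lattice_snd \<tau> w < 1} < \<infinity>"
          using emeasure_fundamental_parallelogram(2) by (simp add: eq top.not_eq_extremum)
      qed (use r in \<open>auto simp: lattice_coords_real_multiple one\<close>)
    qed
  next
    case True
    then have "n \<noteq> 0" using assms by simp
    obtain r :: real where r: "0 \<le> r" "r < 1" "of_int n * r \<notin> \<int>"
      using \<open>n \<noteq> 0\<close> by (rule int_multiple_not_Ints)
    have eq: "?P = {w. 0 \<le> lattice_snd \<tau> w \<and> lattice_snd \<tau> w < 1 \<and> (0 \<le> lattice_fst \<tau> w \<and> lattice_fst \<tau> w < 1)}"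
      by (auto simp: fundamental_parallelogram_eq)
    show thesis
    proof (rule that[of "of_real r * \<tau>"])
      show "torus_char \<tau> m n (of_real r * \<tau>) \<noteq> 1"
        using r by (simp add: torus_char_eq_1_iff lattice_coords_real_multiple)
      show "(LINT w|lborel. indicat_real ?P w *\<^sub>R torus_char \<tau> m n (w + of_real r * \<tau>)) =
         (LINT w|lborel. indicat_real ?P w *\<^sub>R torus_char \<tau> m n w)"
        unfolding eq
      proof (rule lborel_integral_periodic_shift[where r = r and d = \<tau> and B = 1])
        show "torus_char \<tau> m n (w + \<tau>) = torus_char \<tau> m n w" for w
          by (rule per) (simp add: in_lattice_iff one)
        show "emeasure lborel {w. 0 \<le> lattice_snd \<tau> w \<and> lattice_snd \<tau> w < 1 \<and> 0 \<le> lattice_fst \<tau> w \<and> lattice_fst \<tau> w < 1} < \<infinity>"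
          using emeasure_fundamental_parallelogram(2) by (simp add: eq top.not_eq_extremum)
      qed (use r in \<open>auto simp: lattice_coords_real_multiple one\<close>)
    qed
  qed
  have "?I = (LINT w|torus_measure. torus_char \<tau> m n (w + v))"
    using v(2) by (simp add: torus)
  also have "\<dots> = ?I * torus_char \<tau> m n v"
    by (simp add: torus_char_add)
  finally have "?I * (torus_char \<tau> m n v - 1) = 0"
    by (simp add: algebra_simps)
  then show ?thesis
    using v(1) by simp
qed

subsection \<open>Equidistribution\<close>

lemma integrable_torus_measure:
  fixes g :: "complex \<Rightarrow> 'b::{banach, second_countable_topology}"
  assumes "g \<in> borel_measurable lebesgue" "\<And>w. norm (g w) \<le> B"
  shows "integrable torus_measure g"
  using assms by (intro finite_measure.integrable_const_bound[OF finite_measure_torus]) auto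

lemma integral_torus_measure_const: "(LINT w|torus_measure. c) = (c::'b::{banach, second_countable_topology})"
  using measure_torus_UNIV by simp

lemma integrable_torus_char: "integrable torus_measure (torus_char \<tau> m n)"
proof (rule integrable_torus_measure)
  show "torus_char \<tau> m n \<in> borel_measurable lebesgue"
    using borel_measurable_continuous_onI[OF continuous_on_torus_char]
    by (intro measurable_completion) simp
  show "norm (torus_char \<tau> m n w) \<le> 1" for w
    by simp
qed

text \<open>Along the orbit a character runs through the powers of its value at \<open>z\<close>,
  which by assumption is not \<open>1\<close> in the nontrivial case. Integrability is carried
  through the induction because additivity of the integral requires it.\<close>

lemma trig_poly_equidistributed:
  assumes z: "\<And>m n. (m, n) \<noteq> (0, 0) \<Longrightarrow> torus_char \<tau> m n z \<noteq> 1" and p: "trig_poly \<tau> p"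
  shows "integrable torus_measure p \<and>
    (\<lambda>N. (\<Sum>n<N. p (of_nat n * z)) / of_nat N) \<longlonglongrightarrow> (LINT w|torus_measure. p w)"
  using p
proof induction
  case (monomial c m n)
  have "(\<lambda>N. (\<Sum>k<N. c * torus_char \<tau> m n (of_nat k * z)) / of_nat N) \<longlonglongrightarrow>
      (LINT w|torus_measure. c * torus_char \<tau> m n w)"
  proof (cases "(m, n) = (0, 0)")
    case True
    \<comment> \<open>Only eventually: for \<open>N = 0\<close> the quotient is \<open>0\<close> by
      convention.\<close>
    have "\<forall>\<^sub>F N in sequentially. (\<Sum>k<N. c) / of_nat N = c"
      using eventually_gt_at_top[of 0] by eventually_elim simp
    then show ?thesis
      using True by (simp add: measure_torus_UNIV tendsto_eventually)
  next
    case False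
    then show ?thesis
      using tendsto_cesaro_power[OF norm_torus_char z[OF False], of c]
      by (simp add: integral_torus_char[OF False] torus_char_multiple)
  qed
  then show ?case
    by (simp add: integrable_torus_char)
next
  case (add p q)
  then have "(\<lambda>N. (\<Sum>n<N. p (of_nat n * z)) / of_nat N + (\<Sum>n<N. q (of_nat n * z)) / of_nat N) \<longlonglongrightarrow>
      (LINT w|torus_measure. p w) + (LINT w|torus_measure. q w)"
    by (intro tendsto_add) auto
  then show ?case
    using add by (simp add: sum.distrib add_divide_distrib)
qed

text \<open>Stone-Weierstrass is applied on a compact model of the torus in the product of two
  complex planes, the image of \<open>E\<close>. The fibres of \<open>E\<close> lie in single
  lattice cosets, so \<open>g\<close> descends to a function on the image.\<close>

lemma trig_poly_dense:
  fixes g :: "complex \<Rightarrow> real"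
  assumes g: "continuous_on UNIV g" "lattice_periodic \<tau> g" and "0 < e"
  obtains q where "continuous_on UNIV q" "trig_poly \<tau> (\<lambda>w. complex_of_real (q w))"
    "\<And>w. \<bar>g w - q w\<bar> < e"
proof -
  define E where "E w = (torus_char \<tau> 1 0 w, torus_char \<tau> 0 1 w)" for w
  define Q where "Q = closure (fundamental_parallelogram \<tau>)"
  \<comment> \<open>The inverse picks an arbitrary preimage; periodicity of \<open>g\<close> makes
    the value independent of the choice.\<close>
  define h where "h = g \<circ> inv E"
  have "compact Q"
    unfolding Q_def using bounded_fundamental_parallelogram by simp
  have contE: "continuous_on A E" for A
    unfolding E_def[abs_def] by (intro continuous_on_Pair continuous_on_torus_char)
  have E_eq: "E u = E v \<Longrightarrow> u - v \<in> lattice \<tau>" for u v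
  proof -
    assume "E u = E v"
    moreover have "torus_char \<tau> m n u = torus_char \<tau> m n (u - v) * torus_char \<tau> m n v" for m n
      by (simp flip: torus_char_add)
    moreover have "torus_char \<tau> m n v \<noteq> 0" for m n
      by (metis norm_torus_char norm_zero zero_neq_one)
    ultimately have "torus_char \<tau> 1 0 (u - v) = 1" "torus_char \<tau> 0 1 (u - v) = 1"
      unfolding E_def by (metis mult_cancel_right1 prod.inject)+
    then show "u - v \<in> lattice \<tau>"
      by (simp add: torus_char_eq_1_iff in_lattice_iff)
  qed
  have hE: "h (E w) = g w" for w
  proof -
    have "E (inv E (E w)) = E w"
      by (rule f_inv_into_f) simp
    then have "inv E (E w) - w \<in> lattice \<tau>"
      by (rule E_eq)
    then have "g (w + (inv E (E w) - w)) = g w"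
      using g(2) unfolding lattice_periodic_def by blast
    then show ?thesis by (simp add: h_def)
  qed
  have range: "E w \<in> E ` Q" for w
  proof -
    obtain v where v: "v \<in> lattice \<tau>" "w + v \<in> fundamental_parallelogram \<tau>"
      using lattice_translate_in_parallelogram by blast
    then have "E (w + v) = E w"
      using lattice_periodic_torus_char by (simp add: E_def lattice_periodic_def)
    moreover have "w + v \<in> Q"
      using v(2) closure_subset unfolding Q_def by blast
    ultimately show ?thesis by (metis imageI)
  qed
  have conth: "continuous_on (E ` Q) h"
    by (rule continuous_on_factor_compact[OF \<open>compact Q\<close> contE continuous_on_subset[OF g(1)]])
      (auto simp: hE)
  \<comment> \<open>The approximating algebra: real functions on the ambient space whose pullbacks
    are trigonometric polynomials. The four real coordinates belong to it and separate
    points.\<close>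
  let ?R = "\<lambda>f. continuous_on UNIV f \<and> trig_poly \<tau> (\<lambda>w. complex_of_real (f (E w)))"
  have Re_coord: "?R (\<lambda>x. Re (fst x))" "?R (\<lambda>x. Re (snd x))" "?R (\<lambda>x. Im (fst x))" "?R (\<lambda>x. Im (snd x))"
  proof -
    \<comment> \<open>The conjugate of a character is the character with negated indices, so real
      and imaginary parts are combinations of two characters.\<close>
    have Re: "complex_of_real (Re (torus_char \<tau> m n w)) = 1/2 * torus_char \<tau> m n w + 1/2 * torus_char \<tau> (-m) (-n) w"
      and Im: "complex_of_real (Im (torus_char \<tau> m n w)) =
        (- \<i>/2) * torus_char \<tau> m n w + (\<i>/2) * torus_char \<tau> (-m) (-n) w" for m n w
    proof -
      have "torus_char \<tau> (-m) (-n) w = cnj (torus_char \<tau> m n w)"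
        by (simp add: torus_char_def cis_cnj algebra_simps)
      then show "complex_of_real (Re (torus_char \<tau> m n w)) = 1/2 * torus_char \<tau> m n w + 1/2 * torus_char \<tau> (-m) (-n) w"
        "complex_of_real (Im (torus_char \<tau> m n w)) =
          (- \<i>/2) * torus_char \<tau> m n w + (\<i>/2) * torus_char \<tau> (-m) (-n) w"
        by (simp_all add: complex_eq_iff)
    qed
    have "trig_poly \<tau> (\<lambda>w. complex_of_real (Re (torus_char \<tau> m n w)))"
      "trig_poly \<tau> (\<lambda>w. complex_of_real (Im (torus_char \<tau> m n w)))" for m n
      unfolding Re Im by (intro trig_poly.intros)+
    then show "?R (\<lambda>x. Re (fst x))" "?R (\<lambda>x. Re (snd x))" "?R (\<lambda>x. Im (fst x))" "?R (\<lambda>x. Im (snd x))"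
      by (auto simp: E_def intro!: continuous_intros)
  qed
  have "\<exists>f. ?R f \<and> (\<forall>x\<in>E ` Q. \<bar>h x - f x\<bar> < e)"
  proof (rule Stone_Weierstrass_HOL)
    show "compact (E ` Q)"
      by (rule compact_continuous_image[OF contE \<open>compact Q\<close>])
    show "?R (\<lambda>x. c)" for c
      by (simp add: trig_poly_const)
    show "continuous_on (E ` Q) f" if "?R f" for f
      using that continuous_on_subset by blast
    show "?R (\<lambda>x. f x + g x)" "?R (\<lambda>x. f x * g x)" if "?R f \<and> ?R g" for f g
      using that by (auto intro!: continuous_intros trig_poly.add trig_poly_mult)
    show "\<exists>f. ?R f \<and> f x \<noteq> f y" if "x \<in> E ` Q \<and> y \<in> E ` Q \<and> x \<noteq> y" for x y
    proof -
      have "Re (fst x) \<noteq> Re (fst y) \<or> Re (snd x) \<noteq> Re (snd y) \<or> Im (fst x) \<noteq> Im (fst y) \<or> Im (snd x) \<noteq> Im (snd y)"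
        using that by (auto simp: prod_eq_iff complex_eq_iff)
      then show ?thesis using Re_coord by blast
    qed
  qed (use conth \<open>0 < e\<close> in auto)
  then obtain f where f: "?R f" "\<And>x. x \<in> E ` Q \<Longrightarrow> \<bar>h x - f x\<bar> < e" by blast
  show thesis
  proof (rule that[of "f \<circ> E"])
    show "continuous_on UNIV (f \<circ> E)"
      using f(1) contE by (meson continuous_on_compose continuous_on_subset subset_UNIV)
    show "trig_poly \<tau> (\<lambda>w. complex_of_real ((f \<circ> E) w))"
      using f(1) by simp
    show "\<bar>g w - (f \<circ> E) w\<bar> < e" for w
      using f(2)[OF range, of w] by (simp add: hE)
  qed
qed

section \<open>From trigonometric polynomials to almost everywhere continuous functions\<close>

lemma continuous_periodic_bounded:
  fixes g :: "complex \<Rightarrow> real"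
  assumes g: "continuous_on UNIV g" "lattice_periodic \<tau> g"
  obtains B where "\<And>w. \<bar>g w\<bar> \<le> B"
proof -
  have "compact (g ` closure (fundamental_parallelogram \<tau>))"
    using bounded_fundamental_parallelogram g(1)
    by (intro compact_continuous_image) (auto intro: continuous_on_subset)
  then have "bounded (g ` closure (fundamental_parallelogram \<tau>))"
    by (rule compact_imp_bounded)
  then obtain B where B: "\<And>w. w \<in> closure (fundamental_parallelogram \<tau>) \<Longrightarrow> \<bar>g w\<bar> \<le> B"
    by (auto simp: bounded_iff)
  show thesis
  proof (rule that)
    fix w
    obtain v where v: "v \<in> lattice \<tau>" "w + v \<in> fundamental_parallelogram \<tau>"
      using lattice_translate_in_parallelogram by blast
    then have "g w = g (w + v)"
      using g(2) by (simp add: lattice_periodic_def)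
    then show "\<bar>g w\<bar> \<le> B"
      using B v(2) closure_subset by auto
  qed
qed

text \<open>A uniform approximation within \<open>e / 3\<close> changes both the mean and every
  orbit average by at most \<open>e / 3\<close>; the last third is the convergence for the
  approximating polynomial.\<close>

lemma continuous_periodic_equidistributed:
  fixes g :: "complex \<Rightarrow> real"
  assumes z: "\<And>m n. (m, n) \<noteq> (0, 0) \<Longrightarrow> torus_char \<tau> m n z \<noteq> 1"
    and g: "continuous_on UNIV g" "lattice_periodic \<tau> g"
  shows "(\<lambda>N. (\<Sum>n<N. g (of_nat n * z)) / real N) \<longlonglongrightarrow> (LINT w|torus_measure. g w)"
proof (rule LIMSEQ_I)
  fix e :: real assume "0 < e"
  then obtain q where q: "continuous_on UNIV q" "trig_poly \<tau> (\<lambda>w. complex_of_real (q w))"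
      "\<And>w. \<bar>g w - q w\<bar> < e / 3"
    using trig_poly_dense[OF g, of "e/3"] by auto
  have "integrable torus_measure (\<lambda>w. complex_of_real (q w))"
    "(\<lambda>N. (\<Sum>n<N. complex_of_real (q (of_nat n * z))) / of_nat N) \<longlonglongrightarrow> (LINT w|torus_measure. complex_of_real (q w))"
    using trig_poly_equidistributed[OF z q(2)] by auto
  moreover have "(\<Sum>n<N. complex_of_real (q (of_nat n * z))) / of_nat N =
      complex_of_real ((\<Sum>n<N. q (of_nat n * z)) / real N)" for N
    by simp
  ultimately have intq: "integrable torus_measure q"
    and lim: "(\<lambda>N. (\<Sum>n<N. q (of_nat n * z)) / real N) \<longlonglongrightarrow> (LINT w|torus_measure. q w)"
    by (simp_all only: complex_of_real_integrable_eq integral_complex_of_real tendsto_of_real_iff)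
  obtain B where "\<And>w. \<bar>g w\<bar> \<le> B"
    using continuous_periodic_bounded[OF g] by blast
  then have intg: "integrable torus_measure g"
    using g(1) by (intro integrable_torus_measure[where B = B])
      (auto intro!: measurable_completion borel_measurable_continuous_onI)
  have "\<bar>(LINT w|torus_measure. g w) - (LINT w|torus_measure. q w)\<bar> = \<bar>LINT w|torus_measure. g w - q w\<bar>"
    using intg intq by simp
  also have "\<dots> \<le> (LINT w|torus_measure. \<bar>g w - q w\<bar>)"
    by (rule integral_abs_bound)
  also have "\<dots> \<le> (LINT w|torus_measure. e / 3)"
  proof (rule integral_mono)
    show "integrable torus_measure (\<lambda>w. e / 3)"
      by (rule finite_measure.integrable_const[OF finite_measure_torus])
  qed (use intg intq q(3) in \<open>auto intro: less_imp_le\<close>)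
  also have "\<dots> = e / 3"
    by (rule integral_torus_measure_const)
  finally have int: "\<bar>(LINT w|torus_measure. g w) - (LINT w|torus_measure. q w)\<bar> \<le> e / 3" .
  have avg: "\<bar>(\<Sum>n<N. g (of_nat n * z)) / real N - (\<Sum>n<N. q (of_nat n * z)) / real N\<bar> \<le> e / 3" for N
  proof -
    have "\<bar>\<Sum>n<N. g (of_nat n * z) - q (of_nat n * z)\<bar> \<le> (\<Sum>n<N. e / 3)"
      using q(3) by (intro sum_abs[THEN order_trans] sum_mono) (auto intro: less_imp_le)
    then have "\<bar>\<Sum>n<N. g (of_nat n * z) - q (of_nat n * z)\<bar> / real N \<le> real N * (e / 3) / real N"
      by (intro divide_right_mono) auto
    \<comment> \<open>An inequality rather than an equality because the left side is
      \<open>0\<close> for \<open>N = 0\<close>.\<close>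
    also have "\<dots> \<le> e / 3"
      using \<open>0 < e\<close> by simp
    finally show ?thesis
      by (simp add: sum_subtractf flip: diff_divide_distrib)
  qed
  obtain M where M: "\<And>N. M \<le> N \<Longrightarrow> \<bar>(\<Sum>n<N. q (of_nat n * z)) / real N - (LINT w|torus_measure. q w)\<bar> < e / 3"
    using LIMSEQ_D[OF lim, of "e/3"] \<open>0 < e\<close> by auto
  then show "\<exists>M. \<forall>N\<ge>M. norm ((\<Sum>n<N. g (of_nat n * z)) / real N - (LINT w|torus_measure. g w)) < e"
  proof (intro exI[of _ M] allI impI)
    fix N assume "M \<le> N"
    from M[OF this] avg[of N] int
    show "norm ((\<Sum>n<N. g (of_nat n * z)) / real N - (LINT w|torus_measure. g w)) < e"
      unfolding real_norm_def by linarith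
  qed
qed

text \<open>By dominated convergence some Lipschitz majorant still has mean below \<open>c\<close>.
  It is continuous and periodic, so its averages are eventually below \<open>c\<close>, and they
  bound those of \<open>f\<close>.\<close>

lemma AE_continuous_periodic_averages_upper:
  fixes f :: "complex \<Rightarrow> real"
  assumes z: "\<And>m n. (m, n) \<noteq> (0, 0) \<Longrightarrow> torus_char \<tau> m n z \<noteq> 1"
    and f: "\<And>w. \<bar>f w\<bar> \<le> B" "lattice_periodic \<tau> f" "negligible {w. \<not> isCont f w}"
    and "(LINT w|torus_measure. f w) < c"
  shows "\<forall>\<^sub>F N in sequentially. (\<Sum>n<N. f (of_nat n * z)) / real N < c"
proof -
  let ?g = "\<lambda>k. sup_convolution f (real k)"
  have contg: "continuous_on UNIV (?g k)" for k
    by (rule lipschitz_on_continuous_on[OF sup_convolution_lipschitz[OF f(1)]]) simp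
  have "(\<lambda>k. LINT w|torus_measure. ?g k w) \<longlonglongrightarrow> (LINT w|torus_measure. f w)"
  proof (rule integral_dominated_convergence[where w = "\<lambda>_. B"])
    show "f \<in> borel_measurable torus_measure"
      using borel_measurable_lebesgue_AE_continuous[OF f(3)] by simp
    have "?g k \<in> borel_measurable lebesgue" for k
      using borel_measurable_continuous_onI[OF contg] by (intro measurable_completion) simp
    then show "?g k \<in> borel_measurable torus_measure" for k
      by simp
    show "integrable torus_measure (\<lambda>_. B)"
      by (rule finite_measure.integrable_const[OF finite_measure_torus])
    show "AE w in torus_measure. norm (?g k w) \<le> B" for k
      by (simp add: abs_sup_convolution_le[OF f(1)])
    have "AE w in lebesgue. w \<notin> {w. \<not> isCont f w}"
      using f(3) by (intro AE_not_in) (simp add: negligible_iff_null_sets)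
    then have "AE w in lebesgue. w \<in> fundamental_parallelogram \<tau> \<longrightarrow> (\<lambda>k. ?g k w) \<longlonglongrightarrow> f w"
      by eventually_elim (auto intro: sup_convolution_tendsto[OF f(1)])
    then show "AE w in torus_measure. (\<lambda>k. ?g k w) \<longlonglongrightarrow> f w"
      using sets_fundamental_parallelogram by (intro AE_uniform_measureI) auto
  qed
  then have "\<forall>\<^sub>F k in sequentially. (LINT w|torus_measure. ?g k w) < c"
    using assms(5) by (rule order_tendstoD)
  then obtain k where k: "(LINT w|torus_measure. ?g k w) < c"
    using eventually_happens' sequentially_bot by blast
  have "(\<lambda>N. (\<Sum>n<N. ?g k (of_nat n * z)) / real N) \<longlonglongrightarrow> (LINT w|torus_measure. ?g k w)"
    using z contg lattice_periodic_sup_convolution[OF f(2)] by (rule continuous_periodic_equidistributed)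
  then have "\<forall>\<^sub>F N in sequentially. (\<Sum>n<N. ?g k (of_nat n * z)) / real N < c"
    using k by (rule order_tendstoD)
  then show ?thesis
  proof eventually_elim
    case (elim N)
    have "(\<Sum>n<N. f (of_nat n * z)) / real N \<le> (\<Sum>n<N. ?g k (of_nat n * z)) / real N"
      by (intro divide_right_mono sum_mono sup_convolution_ge[OF f(1)]) auto
    then show ?case using elim by simp
  qed
qed

lemma AE_continuous_periodic_equidistributed:
  fixes f :: "complex \<Rightarrow> real"
  assumes z: "\<And>m n. (m, n) \<noteq> (0, 0) \<Longrightarrow> torus_char \<tau> m n z \<noteq> 1"
    and f: "\<And>w. \<bar>f w\<bar> \<le> B" "lattice_periodic \<tau> f" "negligible {w. \<not> isCont f w}"
  shows "(\<lambda>N. (\<Sum>n<N. f (of_nat n * z)) / real N) \<longlonglongrightarrow> (LINT w|torus_measure. f w)"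
proof (rule order_tendstoI)
  show "\<forall>\<^sub>F N in sequentially. (\<Sum>n<N. f (of_nat n * z)) / real N < c"
    if "(LINT w|torus_measure. f w) < c" for c
    using z f that by (rule AE_continuous_periodic_averages_upper)
  show "\<forall>\<^sub>F N in sequentially. c < (\<Sum>n<N. f (of_nat n * z)) / real N"
    if "c < (LINT w|torus_measure. f w)" for c
  proof -
    \<comment> \<open>Lower bounds come from the upper estimate applied to \<open>- f\<close>, which
      has the same points of discontinuity.\<close>
    have "isCont f w" if "isCont (\<lambda>w. - f w) w" for w
      using continuous_minus[OF that] by simp
    then have "negligible {w. \<not> isCont (\<lambda>w. - f w) w}"
      by (intro negligible_subset[OF f(3)]) (auto intro: continuous_minus)
    then have "\<forall>\<^sub>F N in sequentially. (\<Sum>n<N. - f (of_nat n * z)) / real N < - c"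
      using f that
      by (intro AE_continuous_periodic_averages_upper[OF z]) (auto simp: lattice_periodic_def)
    then show ?thesis
      by (simp add: sum_negf)
  qed
qed

text \<open>Integrability only concerns the extension of \<open>f\<close> by zero from the
  parallelogram; lattice translations carry the conclusions to the whole plane. Countability of the
  lattice keeps the set of discontinuities negligible.\<close>

lemma riemann_integrable_periodic:
  fixes f :: "complex \<Rightarrow> real"
  assumes per: "lattice_periodic \<tau> f" and f: "riemann_integrable_on f (fundamental_parallelogram \<tau>)"
  obtains B where "\<And>w. \<bar>f w\<bar> \<le> B" "negligible {w. \<not> isCont f w}"
proof -
  let ?P = "fundamental_parallelogram \<tau>"
  define g where "g w = (if w \<in> ?P then f w else 0)" for w
  obtain a b where P: "?P \<subseteq> box a b" and g: "riemann_integrable_cbox g a b"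
    using f unfolding riemann_integrable_on_def g_def by blast
  obtain w0 where "w0 \<in> ?P"
    using lattice_translate_in_parallelogram by blast
  then have "box a b \<noteq> {}"
    using P by blast
  \<comment> \<open>The open box contains the nonempty parallelogram, so it is not degenerate, as
    boundedness requires.\<close>
  then have "measure lborel (cbox a b) \<noteq> 0"
    using content_pos_lt_eq[of a b] by (auto simp: box_ne_empty)
  then obtain B where B: "\<And>w. w \<in> cbox a b \<Longrightarrow> \<bar>g w\<bar> \<le> B"
    using riemann_integrable_cbox_bounded[OF g] unfolding bounded_iff by auto
  have "\<bar>f w\<bar> \<le> B" for w
  proof -
    obtain v where v: "v \<in> lattice \<tau>" "w + v \<in> ?P"
      using lattice_translate_in_parallelogram by blast
    then have "f w = g (w + v)"
      using per by (simp add: lattice_periodic_def g_def)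
    then show "\<bar>f w\<bar> \<le> B"
      using B[of "w + v"] v(2) P box_subset_cbox[of a b] by auto
  qed
  moreover have "negligible {w. \<not> isCont f w}"
  proof -
    \<comment> \<open>The extension by zero agrees with \<open>f\<close> near interior points of the
      parallelogram but may differ from it near the frontier, which is therefore thrown in.\<close>
    let ?D = "{w \<in> cbox a b. \<not> isCont g w} \<union> frontier ?P"
    have "negligible ?D"
      by (intro negligible_Un riemann_integrable_cbox_negligible_discont[OF g] negligible_convex_frontier
          convex_fundamental_parallelogram)
    then have "negligible (\<Union>v\<in>lattice \<tau>. (+) v ` ?D)"
      by (intro negligible_countable_Union countable_image countable_lattice)
        (auto simp only: intro!: negligible_translation)
    moreover have "{w. \<not> isCont f w} \<subseteq> (\<Union>v\<in>lattice \<tau>. (+) v ` ?D)"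
    proof
      fix w assume "w \<in> {w. \<not> isCont f w}"
      then have w: "\<not> isCont f w" by simp
      obtain v where v: "v \<in> lattice \<tau>" "w + v \<in> ?P"
        using lattice_translate_in_parallelogram by blast
      have "w + v \<in> ?D"
      proof (cases "w + v \<in> interior ?P")
        case True
        have "\<not> isCont g (w + v)"
        proof
          assume "isCont g (w + v)"
          moreover have "\<forall>\<^sub>F x in nhds (w + v). g x = f x"
            using True interior_subset
            by (intro eventually_nhds[THEN iffD2] exI[of _ "interior ?P"]) (auto simp: g_def)
          ultimately have "isCont f (w + v)"
            using isCont_cong by blast
          then have "isCont (\<lambda>x. f (x + v)) w"
            by (intro isCont_o2[where f = "\<lambda>x. x + v" and g = f]) (auto intro: continuous_intros)
          moreover have "(\<lambda>x. f (x + v)) = f"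
            using per v(1) by (auto simp: lattice_periodic_def)
          ultimately show False using w by simp
        qed
        then show ?thesis
          using v(2) P box_subset_cbox by blast
      next
        case False
        then show ?thesis
          using v(2) closure_subset by (force simp: frontier_def)
      qed
      moreover have "w = (- v) + (w + v)" by simp
      ultimately have "w \<in> (+) (- v) ` ?D" by (rule image_eqI[rotated])
      then show "w \<in> (\<Union>v\<in>lattice \<tau>. (+) v ` ?D)"
        using uminus_in_lattice[OF v(1)] by blast
    qed
    ultimately show ?thesis by (rule negligible_subset)
  qed
  ultimately show thesis by (rule that)
qed

section \<open>The converse: orbits in the kernel of a nontrivial character\<close>

lemma fundamental_parallelogram_unique:
  assumes "u \<in> fundamental_parallelogram \<tau>" "v \<in> fundamental_parallelogram \<tau>" "u - v \<in> lattice \<tau>"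
  shows "u = v"
proof -
  have "lattice_fst \<tau> u - lattice_fst \<tau> v \<in> \<int>" "lattice_snd \<tau> u - lattice_snd \<tau> v \<in> \<int>"
    using assms(3) by (simp_all add: in_lattice_iff)
  moreover have "\<bar>lattice_fst \<tau> u - lattice_fst \<tau> v\<bar> < 1" "\<bar>lattice_snd \<tau> u - lattice_snd \<tau> v\<bar> < 1"
    using assms(1,2) unfolding fundamental_parallelogram_eq by auto
  ultimately have "lattice_fst \<tau> u - lattice_fst \<tau> v = 0" "lattice_snd \<tau> u - lattice_snd \<tau> v = 0"
    using Ints_nonzero_abs_ge1 by fastforce+
  then show ?thesis
    by (metis eq_iff_diff_eq_0 lattice_coords_expand)
qed

text \<open>One coordinate is set to \<open>1/2\<close> to stay away from the boundary; the other,
  whose coefficient is nonzero, is chosen to avoid integer values of the linear form.\<close>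

lemma torus_char_nontrivial_in_interior:
  assumes "(m, n) \<noteq> (0, 0)"
  obtains w where "0 < lattice_fst \<tau> w" "lattice_fst \<tau> w < 1" "0 < lattice_snd \<tau> w" "lattice_snd \<tau> w < 1"
    "torus_char \<tau> m n w \<noteq> 1"
proof -
  \<comment> \<open>Doubling makes the contribution of the coordinate \<open>1/2\<close> an integer,
    which is why \<open>r\<close> is chosen for the coefficient \<open>2 * j\<close>.\<close>
  have half: "of_int j * r + of_int k * (1/2) \<notin> \<int>" if "of_int (2 * j) * r \<notin> \<int>" for j k :: int and r :: real
  proof
    assume "of_int j * r + of_int k * (1/2) \<in> \<int>"
    then have "2 * (of_int j * r + of_int k * (1/2)) - of_int k \<in> \<int>"
      by (intro Ints_diff Ints_mult) auto
    then show False
      using that by (simp add: algebra_simps)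
  qed
  have "\<exists>s t. 0 < s \<and> s < 1 \<and> 0 < t \<and> t < 1 \<and> of_int m * s + of_int n * t \<notin> (\<int> :: real set)"
  proof (cases "m = 0")
    case False
    then obtain r :: real where r: "0 \<le> r" "r < 1" "of_int (2 * m) * r \<notin> \<int>"
      using int_multiple_not_Ints[of "2 * m"] by auto
    moreover from r(3) have "r \<noteq> 0" by auto
    ultimately show ?thesis
      using half[of m r n] by (intro exI[of _ r] exI[of _ "1/2"]) auto
  next
    case True
    then obtain r :: real where r: "0 \<le> r" "r < 1" "of_int (2 * n) * r \<notin> \<int>"
      using int_multiple_not_Ints[of "2 * n"] assms by auto
    moreover from r(3) have "r \<noteq> 0" by auto
    ultimately show ?thesis
      using half[of n r m] by (intro exI[of _ "1/2"] exI[of _ r]) (auto simp: add.commute)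
  qed
  then obtain s t where "0 < s" "s < 1" "0 < t" "t < 1" "of_int m * s + of_int n * t \<notin> (\<int> :: real set)"
    by blast
  then show thesis
    by (intro that[of "of_real s + of_real t * \<tau>"])
      (simp_all only: lattice_coords_eq torus_char_eq_1_iff not_False_eq_True)
qed

lemma torus_char_eq_1_imp_not_equidistributed:
  assumes mn: "(m, n) \<noteq> (0, 0)" and z: "torus_char \<tau> m n z = 1"
  shows "\<not> torus_equidistributed \<tau> (\<lambda>k. torus_class \<tau> (of_nat k * z))"
proof
  assume equi: "torus_equidistributed \<tau> (\<lambda>k. torus_class \<tau> (of_nat k * z))"
  let ?P = "fundamental_parallelogram \<tau>"
  \<comment> \<open>The bump must live inside the parallelogram, so that it descends to the torus,
    and off the kernel, so that the orbit misses it.\<close>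
  define U where "U = {w. 0 < lattice_fst \<tau> w \<and> lattice_fst \<tau> w < 1 \<and> 0 < lattice_snd \<tau> w \<and> lattice_snd \<tau> w < 1}
    \<inter> {w. torus_char \<tau> m n w \<noteq> 1}"
  have "open U"
    unfolding U_def
    by (intro open_Int open_parallelogram_interior open_Collect_neq continuous_on_torus_char continuous_intros)
  moreover obtain c where "c \<in> U"
    using torus_char_nontrivial_in_interior[OF mn] unfolding U_def by blast
  ultimately obtain r where r: "0 < r" "ball c r \<subseteq> U"
    using open_contains_ball by blast
  have ball_P: "ball c r \<subseteq> ?P"
    using r(2) by (auto simp: U_def fundamental_parallelogram_eq)
  define h where "h w = max 0 (r - dist c w)" for w
  have h_out: "h w = 0" if "w \<notin> ball c r" for w
    using that by (simp add: h_def)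
  \<comment> \<open>A function of a class is evaluated at its unique representative in the
    parallelogram.\<close>
  define f where "f X = h (SOME w. w \<in> ?P \<and> torus_class \<tau> w = X)" for X
  have f_P: "f (torus_class \<tau> w) = h w" if "w \<in> ?P" for w
  proof -
    have "(SOME u. u \<in> ?P \<and> torus_class \<tau> u = torus_class \<tau> w) = w"
      using that fundamental_parallelogram_unique by (intro some_equality) (auto simp: torus_class_eq_iff)
    then show ?thesis by (simp add: f_def)
  qed
  have int: "riemann_integrable_on (\<lambda>w. f (torus_class \<tau> w)) ?P"
  proof -
    obtain a where a: "?P \<subseteq> box (- a) a"
      using bounded_subset_box_symmetric[OF bounded_fundamental_parallelogram] by blast
    \<comment> \<open>Since \<open>h\<close> vanishes outside a ball contained in the parallelogram,
      the extension by zero is \<open>h\<close> itself and hence continuous on the plane.\<close>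
    have "(if w \<in> ?P then f (torus_class \<tau> w) else 0) = h w" for w
      using f_P[of w] h_out[of w] subsetD[OF ball_P, of w] by (cases "w \<in> ?P") auto
    moreover have "riemann_integrable_cbox h (- a) a"
      unfolding h_def by (intro continuous_imp_riemann_integrable_cbox continuous_intros)
    ultimately show ?thesis
      unfolding riemann_integrable_on_def using a by auto
  qed
  have orbit: "f (torus_class \<tau> (of_nat k * z)) = 0" for k
  proof -
    obtain v where v: "v \<in> lattice \<tau>" "of_nat k * z + v \<in> ?P"
      using lattice_translate_in_parallelogram by blast
    \<comment> \<open>The representative of an orbit point still lies in the kernel, while the ball
      consists of points outside it.\<close>
    have "torus_char \<tau> m n (of_nat k * z + v) = torus_char \<tau> m n (of_nat k * z)"
      using lattice_periodic_torus_char v(1) by (simp add: lattice_periodic_def)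
    also have "\<dots> = 1"
      by (simp add: torus_char_multiple z)
    finally have "of_nat k * z + v \<notin> ball c r"
      using r(2) by (auto simp: U_def)
    moreover have "torus_class \<tau> (of_nat k * z) = torus_class \<tau> (of_nat k * z + v)"
      using uminus_in_lattice[OF v(1)] by (simp add: torus_class_eq_iff)
    ultimately show ?thesis
      using f_P[OF v(2)] h_out by simp
  qed
  have "(\<lambda>N. (1 / real N) * (\<Sum>k<N. f (torus_class \<tau> (of_nat k * z)))) \<longlonglongrightarrow>
      (LINT w|torus_measure. f (torus_class \<tau> w))"
    using equi int unfolding torus_equidistributed_def by blast
  then have zero: "(LINT w|torus_measure. f (torus_class \<tau> w)) = 0"
    by (simp add: orbit LIMSEQ_const_iff)
  obtain B where B: "\<And>w. \<bar>f (torus_class \<tau> w)\<bar> \<le> B" "negligible {w. \<not> isCont (\<lambda>w. f (torus_class \<tau> w)) w}"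
    using riemann_integrable_periodic[OF lattice_periodic_torus_class int] by blast
  have "integrable torus_measure (\<lambda>w. f (torus_class \<tau> w))"
    using B by (intro integrable_torus_measure[where B = B] borel_measurable_lebesgue_AE_continuous) auto
  moreover have "AE w in torus_measure. 0 \<le> f (torus_class \<tau> w)"
    by (simp add: f_def h_def)
  \<comment> \<open>A nonnegative function with integral zero vanishes almost everywhere; as
    \<open>h\<close> is positive on the ball, the ball would be negligible.\<close>
  ultimately have "AE w in torus_measure. f (torus_class \<tau> w) = 0"
    using zero integral_nonneg_eq_0_iff_AE by blast
  then have "AE w in lebesgue. w \<in> ?P \<longrightarrow> f (torus_class \<tau> w) = 0"
    using emeasure_fundamental_parallelogram sets_fundamental_parallelogram
    by (subst (asm) AE_uniform_measure) (auto simp: top.not_eq_extremum)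
  then have "AE w in lebesgue. w \<notin> ball c r"
  proof eventually_elim
    case (elim w)
    then show ?case
      using ball_P f_P[of w] by (auto simp: h_def)
  qed
  then have "negligible (ball c r)"
    by (simp add: negligible_iff_null_sets AE_iff_null_sets)
  then show False
    using r(1) open_not_negligible[OF open_ball, of c r] by auto
qed

end

theorem theorem5:
  fixes \<tau> z :: complex
  assumes "Im \<tau> > 0"
  shows "torus_equidistributed \<tau> (\<lambda>n. torus_class \<tau> (of_nat n * z)) \<longleftrightarrow>
    (\<forall>n\<^sub>1 n\<^sub>2 :: int. (n\<^sub>1, n\<^sub>2) \<noteq> (0, 0) \<longrightarrow>
       of_int n\<^sub>1 * Re z + (of_int n\<^sub>2 - of_int n\<^sub>1 * Re \<tau>) / Im \<tau> * Im z \<notin> \<int>)"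
proof -
  \<comment> \<open>Rewriting in lattice coordinates identifies the arithmetic condition with
    nontriviality of every nontrivial character at \<open>z\<close>.\<close>
  have "of_int m * Re z + (of_int n - of_int m * Re \<tau>) / Im \<tau> * Im z \<in> \<int> \<longleftrightarrow> torus_char \<tau> m n z = 1"
    for m n :: int
  proof -
    have "of_int m * Re z + (of_int n - of_int m * Re \<tau>) / Im \<tau> * Im z =
        of_int m * lattice_fst \<tau> z + of_int n * lattice_snd \<tau> z"
      by (simp add: lattice_fst_def lattice_snd_def algebra_simps diff_divide_distrib)
    then show ?thesis by (simp add: torus_char_eq_1_iff)
  qed
  note char = this
  show ?thesis
    unfolding char
  proof
    assume "torus_equidistributed \<tau> (\<lambda>n. torus_class \<tau> (of_nat n * z))"
    then show "\<forall>m n. (m, n) \<noteq> (0, 0) \<longrightarrow> torus_char \<tau> m n z \<noteq> 1"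
      using torus_char_eq_1_imp_not_equidistributed[OF assms] by blast
  next
    assume z: "\<forall>m n. (m, n) \<noteq> (0, 0) \<longrightarrow> torus_char \<tau> m n z \<noteq> 1"
    show "torus_equidistributed \<tau> (\<lambda>n. torus_class \<tau> (of_nat n * z))"
      unfolding torus_equidistributed_def
    proof (intro allI impI)
      fix f :: "complex set \<Rightarrow> real"
      assume "riemann_integrable_on (\<lambda>w. f (torus_class \<tau> w)) (fundamental_parallelogram \<tau>)"
      then obtain B where B: "\<And>w. \<bar>f (torus_class \<tau> w)\<bar> \<le> B" "negligible {w. \<not> isCont (\<lambda>w. f (torus_class \<tau> w)) w}"
        using riemann_integrable_periodic[OF assms lattice_periodic_torus_class[OF assms]] by blast
      have "(\<lambda>N. (\<Sum>n<N. f (torus_class \<tau> (of_nat n * z))) / real N) \<longlonglongrightarrow>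
          (LINT w|uniform_measure lebesgue (fundamental_parallelogram \<tau>). f (torus_class \<tau> w))"
        using z B lattice_periodic_torus_class[OF assms]
        by (intro AE_continuous_periodic_equidistributed[OF assms]) auto
      then show "(\<lambda>N. 1 / real N * (\<Sum>n<N. f (torus_class \<tau> (of_nat n * z)))) \<longlonglongrightarrow>
          (LINT w|uniform_measure lebesgue (fundamental_parallelogram \<tau>). f (torus_class \<tau> w))"
        by simp
    qed
  qed
qed

end
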